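(* Let $u$ be a smooth local solution of the surface growth equation $u_t=-u_{xxxx}-\big((u_x)^2\big)_{xx}$ on $[0,2\pi]$ with periodic boundary conditions, mean zero, and initial condition $u(0)\in\mathcal{H}^1$. Let $n\ge 1$ be an integer and let $\varphi$ be an arbitrary $H_n$-valued approximation, i.e. an arbitrary function of time with $\varphi(\cdot,t)\in H_n$ for each $t$ (no closeness of $\varphi$ to $u$ is assumed). At each fixed time $t$ write $\varphi=\varphi(\cdot,t)$ and let $A_\varphi$, $\lambda$, $\lambda_n$ be the associated operator, the supremum of its quadratic form, and the Galerkin approximation of this supremum, as defined in the context. Set $$C_\varphi = 2\|\varphi_{xxx}\|_\infty + 6\|\varphi_{xx}\|_\infty + 4\|\varphi_x\|_\infty .$$ If $n\ge \sqrt{2}\,C_\varphi$, then $$\lambda_n\le\lambda\le\lambda_n+\frac12\max\Big\{\,2C_\varphi^2\,\frac{9\|\varphi_{xx}\|_\infty^2-2\lambda_n}{n^2}\ ,\ 9\|\varphi_{xx}\|_\infty^2+2\lambda_n-\frac12 n^4\Big\}.$$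
   Context: All functions of the space variable $x$ are real-valued. $\mathcal{H}$ is the Hilbert space of $2\pi$-periodic functions $u:\mathbb{R}\to\mathbb{R}$, square integrable on $[0,2\pi]$, with $\int_0^{2\pi}u(x)\,dx=0$, equipped with the standard $L^2$ scalar product $\langle u,v\rangle=\int_0^{2\pi}u(x)v(x)\,dx$ and norm $\|u\|=\big(\int_0^{2\pi}|u(x)|^2dx\big)^{1/2}$. For $k\in\mathbb{N}$, $\mathcal{H}^k=\{u\in\mathcal{H}:\partial_x^k u\in L^2([0,2\pi])\}$ (periodic Sobolev space of mean-zero functions). $\|\cdot\|_\infty$ denotes the supremum norm in $x$ over $[0,2\pi]$. For an integer $n\ge1$, $H_n\subset\mathcal{H}$ is the $2n$-dimensional space spanned by $e^{ix},\dots,e^{inx}$ and their complex conjugates $e^{-ix},\dots,e^{-inx}$ (its real-valued elements, i.e. the real span of $\cos(kx),\sin(kx)$, $1\le k\le n$). For a given $\varphi$ (at a fixed time, so a function of $x$ only), define the linear, in general non-symmetric, operator $$A_\varphi u=-\partial_x^4u-2\,\partial_x^3(\varphi_x u).$$ Define $$\lambda=\sup\{\langle A_\varphi u,u\rangle : u\in\mathcal{H}^4,\ \|u\|=1\}$$ (equivalently the supremum over $u\in\mathcal{H}^2$ with $\|u\|=1$ of the quadratic form extended by continuity), and $$\lambda_n=\sup\{\langle A_\varphi u,u\rangle : u\in H_n,\ \|u\|=1\}.$$ The dependence of $\lambda$, $\lambda_n$ and $C_\varphi$ on $\varphi$, and hence on time, is suppressed in the notation. *)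

theory Defs
  imports "HOL-Analysis.Analysis"
begin

section \<open>Square-integrable periodic functions\<close>

definition periodic :: "(real \<Rightarrow> real) \<Rightarrow> bool" where
  "periodic f \<longleftrightarrow> (\<forall>x. f (x + 2 * pi) = f x)"

text \<open>Elements of function spaces are represented by functions rather than by classes modulo
  equality almost everywhere; the spaces \<open>L2_per\<close>, \<open>H_space\<close>, \<open>H_sob k\<close> and the integrals are
  invariant under periodic changes on null sets.\<close>

definition L2_per :: "(real \<Rightarrow> real) set" where
  "L2_per = {f. periodic f \<and> set_borel_measurable lebesgue {0..2*pi} f \<and>
     set_integrable lebesgue {0..2*pi} (\<lambda>x. (f x)\<^sup>2)}"

definition ip :: "(real \<Rightarrow> real) \<Rightarrow> (real \<Rightarrow> real) \<Rightarrow> real" where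
  "ip f g = (LINT x:{0..2*pi}|lebesgue. f x * g x)"

definition nrm :: "(real \<Rightarrow> real) \<Rightarrow> real" where
  "nrm f = sqrt (LINT x:{0..2*pi}|lebesgue. \<bar>f x\<bar>\<^sup>2)"

definition sup_nrm :: "(real \<Rightarrow> real) \<Rightarrow> real" where
  "sup_nrm f = (SUP x\<in>{0..2*pi}. \<bar>f x\<bar>)"

definition H_space :: "(real \<Rightarrow> real) set" where
  "H_space = {f \<in> L2_per. (LINT x:{0..2*pi}|lebesgue. f x) = 0}"

section \<open>Weak derivatives and Sobolev spaces\<close>

definition smooth_per :: "(real \<Rightarrow> real) \<Rightarrow> bool" where
  "smooth_per \<psi> \<longleftrightarrow> periodic \<psi> \<and> (\<forall>k x. (deriv ^^ k) \<psi> differentiable (at x))"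

text \<open>\<open>g\<close> is the \<open>k\<close>-th derivative of \<open>f\<close> in the sense of periodic distributions, and
  it lies in \<open>L\<^sup>2\<close>.\<close>

definition has_weak_deriv :: "nat \<Rightarrow> (real \<Rightarrow> real) \<Rightarrow> (real \<Rightarrow> real) \<Rightarrow> bool" where
  "has_weak_deriv k f g \<longleftrightarrow> g \<in> L2_per \<and>
     (\<forall>\<psi>. smooth_per \<psi> \<longrightarrow> ip f ((deriv ^^ k) \<psi>) = (-1) ^ k * ip g \<psi>)"

text \<open>The weak derivative is unique only almost everywhere; the choice of representative does not
  affect any integral. The value is meaningful only if an \<open>L\<^sup>2\<close> weak derivative exists.\<close>

definition weak_deriv :: "nat \<Rightarrow> (real \<Rightarrow> real) \<Rightarrow> real \<Rightarrow> real" where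
  "weak_deriv k f = (SOME g. has_weak_deriv k f g)"

definition H_sob :: "nat \<Rightarrow> (real \<Rightarrow> real) set" where
  "H_sob k = {f \<in> H_space. \<exists>g. has_weak_deriv k f g}"

text \<open>The real-valued elements of the span of \<open>e\<^sup>i\<^sup>k\<^sup>x\<close>, \<open>1 \<le> \<bar>k\<bar> \<le> n\<close>.\<close>

definition H_fin :: "nat \<Rightarrow> (real \<Rightarrow> real) set" where
  "H_fin n = {f. \<exists>a b :: nat \<Rightarrow> real.
     f = (\<lambda>x. \<Sum>k=1..n. a k * cos (real k * x) + b k * sin (real k * x))}"

section \<open>The linearised operator and the suprema of its quadratic form\<close>

definition A_op :: "(real \<Rightarrow> real) \<Rightarrow> (real \<Rightarrow> real) \<Rightarrow> real \<Rightarrow> real" where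
  "A_op \<phi> u = (\<lambda>x. - weak_deriv 4 u x - 2 * weak_deriv 3 (\<lambda>y. deriv \<phi> y * u y) x)"

text \<open>For \<open>\<phi> \<in> H_fin n\<close> the quadratic form is bounded above on the unit sphere, so the following
  suprema of sets of real numbers are genuine (for the second one, if \<open>n \<ge> 1\<close>).\<close>

definition lam :: "(real \<Rightarrow> real) \<Rightarrow> real" where
  "lam \<phi> = Sup {ip (A_op \<phi> u) u | u. u \<in> H_sob 4 \<and> nrm u = 1}"

definition lam_fin :: "nat \<Rightarrow> (real \<Rightarrow> real) \<Rightarrow> real" where
  "lam_fin n \<phi> = Sup {ip (A_op \<phi> u) u | u. u \<in> H_fin n \<and> nrm u = 1}"

definition C_const :: "(real \<Rightarrow> real) \<Rightarrow> real" where
  "C_const \<phi> = 2 * sup_nrm ((deriv ^^ 3) \<phi>) + 6 * sup_nrm ((deriv ^^ 2) \<phi>) + 4 * sup_nrm (deriv \<phi>)"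

section \<open>The surface growth equation\<close>

text \<open>Joint smoothness in time and space on \<open>(0,T) \<times> \<real>\<close>: \<open>D i j\<close> is the mixed partial derivative of
  order \<open>i\<close> in \<open>t\<close> and \<open>j\<close> in \<open>x\<close>.\<close>

definition smooth_tx :: "real \<Rightarrow> (real \<Rightarrow> real \<Rightarrow> real) \<Rightarrow> bool" where
  "smooth_tx T u \<longleftrightarrow> (\<exists>D :: nat \<Rightarrow> nat \<Rightarrow> real \<Rightarrow> real \<Rightarrow> real. D 0 0 = u \<and>
     (\<forall>i j. continuous_on ({0<..<T} \<times> UNIV) (\<lambda>(t, x). D i j t x) \<and>
       (\<forall>t\<in>{0<..<T}. \<forall>x.
          ((\<lambda>s. D i j s x) has_real_derivative D (Suc i) j t x) (at t) \<and>
          (D i j t has_real_derivative D i (Suc j) t x) (at x))))"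

text \<open>A local solution on \<open>[0,T)\<close> whose initial value is only in \<open>H\<^sup>1\<close> is smooth for positive
  times and attains its initial value in \<open>H\<^sup>1\<close>; for functions of mean zero, \<open>\<parallel>\<partial>\<^sub>x v\<parallel>\<close> is a norm on \<open>H\<^sup>1\<close>.\<close>

definition smooth_local_solution :: "real \<Rightarrow> (real \<Rightarrow> real \<Rightarrow> real) \<Rightarrow> bool" where
  "smooth_local_solution T u \<longleftrightarrow> 0 < T \<and> u 0 \<in> H_sob 1 \<and>
     (\<forall>t\<in>{0<..<T}. u t \<in> H_space) \<and> smooth_tx T u \<and>
     (\<forall>t\<in>{0<..<T}. \<forall>x. deriv (\<lambda>s. u s x) t =
        - (deriv ^^ 4) (u t) x - (deriv ^^ 2) (\<lambda>y. (deriv (u t) y)\<^sup>2) x) \<and>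
     ((\<lambda>t. nrm (weak_deriv 1 (\<lambda>x. u t x - u 0 x))) \<longlongrightarrow> 0) (at_right 0)"

end

theory Submission
  imports Defs
begin

text \<open>Write \<open>M = \<parallel>\<phi>\<^sub>x\<^sub>x\<parallel>\<^sub>\<infinity>\<close>. For smooth \<open>u\<close>, integration by parts turns the quadratic form into
  \<open>-\<parallel>u\<^sub>x\<^sub>x\<parallel>\<^sup>2 + \<langle>\<phi>\<^sub>x\<^sub>x u\<^sub>x, u\<^sub>x\<rangle> - 2 \<langle>\<phi>\<^sub>x\<^sub>x u, u\<^sub>x\<^sub>x\<rangle>\<close>, and \<open>\<parallel>u\<^sub>x\<parallel>\<^sup>2 \<le> \<parallel>u\<parallel> \<parallel>u\<^sub>x\<^sub>x\<parallel>\<close> then bounds it by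
  \<open>-\<parallel>u\<^sub>x\<^sub>x\<parallel>\<^sup>2/2 + 9/2 M\<^sup>2 \<parallel>u\<parallel>\<^sup>2\<close> (\<open>qform_upper\<close>). Split \<open>u = p + q\<close>, where \<open>p\<close> carries the Fourier modes
  up to \<open>n\<close> and \<open>q\<close> the others. The mixed terms are at most \<open>C \<parallel>p\<^sub>x\<^sub>x\<parallel> \<parallel>q\<^sub>x\<parallel>\<close> (\<open>qform_cross\<close>), and
  \<open>\<parallel>q\<^sub>x\<parallel> \<le> \<parallel>q\<^sub>x\<^sub>x\<parallel>/n\<close>, so Young's inequality bounds them by \<open>\<parallel>q\<^sub>x\<^sub>x\<parallel>\<^sup>2/4 + C\<^sup>2/n\<^sup>2 \<parallel>p\<^sub>x\<^sub>x\<parallel>\<^sup>2\<close>. The first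
  summand is absorbed by the dissipation of \<open>q\<close>. In the second, \<open>\<parallel>p\<^sub>x\<^sub>x\<parallel>\<^sup>2\<close> is at most
  \<open>9 M\<^sup>2 \<parallel>p\<parallel>\<^sup>2\<close> minus twice the form at \<open>p\<close>; the condition on \<open>n\<close> says \<open>2 C\<^sup>2 \<le> n\<^sup>2\<close>, which keeps the
  total coefficient of the form at \<open>p\<close> nonnegative, so that this form can be replaced by \<open>\<lambda>\<^sub>n \<parallel>p\<parallel>\<^sup>2\<close>.
  The outcome is the estimate
  \<open>(\<lambda>\<^sub>n + C\<^sup>2 (9 M\<^sup>2 - 2 \<lambda>\<^sub>n)/n\<^sup>2) \<parallel>p\<parallel>\<^sup>2 + (9/2 M\<^sup>2 - (n + 1)\<^sup>4/4) \<parallel>q\<parallel>\<^sup>2\<close> (\<open>qform_galerkin_bound\<close>).\<close>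

text \<open>The coefficient of \<open>\<parallel>p\<parallel>\<^sup>2\<close> is the bound coming from the first entry of the maximum. The
  coefficient of \<open>\<parallel>q\<parallel>\<^sup>2\<close> lies below the bound coming from the second entry if \<open>\<lambda>\<^sub>n \<ge> 0\<close>. If \<open>\<lambda>\<^sub>n < 0\<close>, the
  second entry can be too small; but the test function \<open>cos x\<close> gives \<open>\<lambda>\<^sub>n \<ge> -1 - 3 M\<close>, the condition
  on \<open>n\<close> makes \<open>M\<close> small compared with \<open>n\<close>, and the coefficient of \<open>\<parallel>q\<parallel>\<^sup>2\<close> is then at most \<open>\<lambda>\<^sub>n\<close>, while
  the first entry is nonnegative (\<open>tail_coefficient_bound\<close>).\<close>

text \<open>These estimates concern trigonometric sums. They extend to \<open>H\<^sup>4\<close> because the form at \<open>u\<close> is the limit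
  of the form at the Fourier partial sums of \<open>u\<close> (\<open>qform_limit\<close>). The Fourier coefficients of \<open>u\<close> are
  \<open>1/k^4\<close> times those of an \<open>L\<^sup>2\<close> function, so the Fourier series converges uniformly together with its
  first three derivatives; this also produces the third weak derivative of \<open>\<phi>\<^sub>x u\<close> on which the
  operator depends. That the series represents \<open>u\<close> is the completeness of the trigonometric system
  (\<open>trig_orth_imp_ip_zero\<close>).\<close>

section \<open>The L2 scalar product on periodic functions\<close>

abbreviation cont_per :: "(real \<Rightarrow> real) \<Rightarrow> bool" where
  "cont_per f \<equiv> periodic f \<and> continuous_on UNIV f"

lemma ip_sym: "ip f g = ip g f"
  by (simp add: ip_def mult.commute)

lemma nrm_eq: "nrm f = sqrt (ip f f)"
  by (simp add: nrm_def ip_def power2_eq_square abs_mult_self_eq)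

lemma ip_self_nonneg: "0 \<le> ip f f"
  by (simp add: ip_def set_lebesgue_integral_def integral_nonneg)

lemma nrm_nonneg: "0 \<le> nrm f"
  by (simp add: nrm_eq ip_self_nonneg)

lemma nrm_square: "(nrm f)\<^sup>2 = ip f f"
  by (simp add: nrm_eq ip_self_nonneg)

lemma L2_set_borel_mult:
  assumes "f \<in> L2_per" "g \<in> L2_per"
  shows "set_borel_measurable lebesgue {0..2*pi} (\<lambda>x. f x * g x)"
proof -
  have "(\<lambda>x. (indicator {0..2*pi} x *\<^sub>R f x) * (indicator {0..2*pi} x *\<^sub>R g x))
     \<in> borel_measurable lebesgue"
    using assms by (intro borel_measurable_times) (auto simp: L2_per_def set_borel_measurable_def)
  moreover have "(\<lambda>x. (indicator {0..2*pi} x *\<^sub>R f x) * (indicator {0..2*pi} x *\<^sub>R g x))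
     = (\<lambda>x. indicator {0..2*pi} x *\<^sub>R (f x * g x))"
    by (auto simp: indicator_def)
  ultimately show ?thesis by (simp add: set_borel_measurable_def)
qed

lemma L2_mult_integrable:
  assumes "f \<in> L2_per" "g \<in> L2_per"
  shows "set_integrable lebesgue {0..2*pi} (\<lambda>x. f x * g x)"
proof (rule set_integrable_bound)
  show "set_integrable lebesgue {0..2*pi} (\<lambda>x. (f x)\<^sup>2 + (g x)\<^sup>2)"
    using assms by (intro set_integral_add) (auto simp: L2_per_def)
  show "set_borel_measurable lebesgue {0..2*pi} (\<lambda>x. f x * g x)"
    using assms by (rule L2_set_borel_mult)
  have "\<bar>a * b\<bar> \<le> a\<^sup>2 + b\<^sup>2" for a b :: real
  proof -
    have "0 \<le> \<bar>a\<bar> * \<bar>b\<bar>" by simp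
    then show ?thesis
      using sum_squares_bound[of "\<bar>a\<bar>" "\<bar>b\<bar>"] unfolding abs_mult power2_abs by linarith
  qed
  then show "AE x in lebesgue. x \<in> {0..2*pi} \<longrightarrow> norm (f x * g x) \<le> norm ((f x)\<^sup>2 + (g x)\<^sup>2)"
    by simp
qed

lemma cont_per_L2:
  assumes "cont_per f"
  shows "f \<in> L2_per"
proof -
  have c: "continuous_on {0..2*pi} f"
    using assms continuous_on_subset by blast
  have "set_integrable lebesgue {0..2*pi} f"
    using c by (rule absolutely_integrable_continuous_real)
  then have "set_borel_measurable lebesgue {0..2*pi} f"
    by (simp add: set_borel_measurable_def set_integrable_def)
  moreover have "set_integrable lebesgue {0..2*pi} (\<lambda>x. (f x)\<^sup>2)"
    using c by (intro absolutely_integrable_continuous_real continuous_intros)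
  ultimately show ?thesis using assms by (simp add: L2_per_def)
qed

lemma L2_scale: 
  assumes "f \<in> L2_per"
  shows "(\<lambda>x. c * f x) \<in> L2_per"
proof -
  have "(\<lambda>x. c * (indicator {0..2*pi} x *\<^sub>R f x)) \<in> borel_measurable lebesgue"
    using assms by (intro borel_measurable_times) (auto simp: L2_per_def set_borel_measurable_def)
  then have "set_borel_measurable lebesgue {0..2*pi} (\<lambda>x. c * f x)"
    by (simp add: set_borel_measurable_def mult_ac)
  then show ?thesis
    using assms by (auto simp: L2_per_def periodic_def power_mult_distrib)
qed

lemma L2_add:
  assumes "f \<in> L2_per" "g \<in> L2_per"
  shows "(\<lambda>x. f x + g x) \<in> L2_per"
proof -
  have "(\<lambda>x. (indicator {0..2*pi} x *\<^sub>R f x) + (indicator {0..2*pi} x *\<^sub>R g x))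
     \<in> borel_measurable lebesgue"
    using assms by (intro borel_measurable_add) (auto simp: L2_per_def set_borel_measurable_def)
  then have m: "set_borel_measurable lebesgue {0..2*pi} (\<lambda>x. f x + g x)"
    by (simp add: set_borel_measurable_def algebra_simps)
  have "set_integrable lebesgue {0..2*pi} (\<lambda>x. ((f x)\<^sup>2 + 2 * (f x * g x)) + (g x)\<^sup>2)"
    using assms L2_mult_integrable[OF assms]
    by (intro set_integral_add set_integrable_mult_right) (auto simp: L2_per_def)
  moreover have "(\<lambda>x. ((f x)\<^sup>2 + 2 * (f x * g x)) + (g x)\<^sup>2) = (\<lambda>x. (f x + g x)\<^sup>2)"
    by (simp add: power2_sum algebra_simps)
  ultimately show ?thesis
    using m assms by (auto simp: L2_per_def periodic_def)
qed

lemma L2_diff: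
  assumes "f \<in> L2_per" "g \<in> L2_per"
  shows "(\<lambda>x. f x - g x) \<in> L2_per"
  using L2_add[OF assms(1) L2_scale[OF assms(2), of "-1"]] by simp

lemma ip_add_left:
  assumes "f \<in> L2_per" "g \<in> L2_per" "h \<in> L2_per"
  shows "ip (\<lambda>x. f x + g x) h = ip f h + ip g h"
  using set_integral_add(2)[OF L2_mult_integrable[OF assms(1,3)] L2_mult_integrable[OF assms(2,3)]]
  by (simp add: ip_def algebra_simps)

lemma ip_diff_left:
  assumes "f \<in> L2_per" "g \<in> L2_per" "h \<in> L2_per"
  shows "ip (\<lambda>x. f x - g x) h = ip f h - ip g h"
  using set_integral_diff(2)[OF L2_mult_integrable[OF assms(1,3)] L2_mult_integrable[OF assms(2,3)]]
  by (simp add: ip_def algebra_simps)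

lemma ip_scale_left: "ip (\<lambda>x. c * f x) h = c * ip f h"
  by (simp add: ip_def mult.assoc)

lemma ip_add_right:
  assumes "f \<in> L2_per" "g \<in> L2_per" "h \<in> L2_per"
  shows "ip h (\<lambda>x. f x + g x) = ip h f + ip h g"
  using ip_add_left[OF assms] by (simp add: ip_sym)

lemma ip_diff_right:
  assumes "f \<in> L2_per" "g \<in> L2_per" "h \<in> L2_per"
  shows "ip h (\<lambda>x. f x - g x) = ip h f - ip h g"
  using ip_diff_left[OF assms] by (simp add: ip_sym)

lemma ip_scale_right: "ip h (\<lambda>x. c * f x) = c * ip h f"
  using ip_scale_left by (simp add: ip_sym)

lemma Cauchy_Schwarz_ip:
  assumes f: "f \<in> L2_per" and g: "g \<in> L2_per"
  shows "\<bar>ip f g\<bar> \<le> nrm f * nrm g"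
proof -
  have q: "0 \<le> ip f f - 2 * s * ip f g + s\<^sup>2 * ip g g" for s
  proof -
    have "0 \<le> ip (\<lambda>x. f x - s * g x) (\<lambda>x. f x - s * g x)"
      by (rule ip_self_nonneg)
    also have "\<dots> = ip f f - 2 * s * ip f g + s\<^sup>2 * ip g g"
      using f g by (simp add: ip_diff_left ip_diff_right L2_diff L2_scale ip_scale_left
          ip_scale_right ip_sym[of g f] power2_eq_square algebra_simps)
    finally show ?thesis .
  qed
  have "(ip f g)\<^sup>2 \<le> ip f f * ip g g"
  proof (cases "ip g g = 0")
    case True
    have "ip f g = 0"
    proof (rule ccontr)
      assume "ip f g \<noteq> 0"
      then show False
        using q[of "(ip f f + 1) / (2 * ip f g)"] True by simp
    qed
    then show ?thesis using True by simp
  next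
    case False
    then have "ip g g > 0" using ip_self_nonneg[of g] by simp
    then show ?thesis
      using q[of "ip f g / ip g g"] by (simp add: field_simps power2_eq_square)
  qed
  then have "(ip f g)\<^sup>2 \<le> (nrm f * nrm g)\<^sup>2"
    by (simp add: power_mult_distrib nrm_square)
  then show ?thesis
    using nrm_nonneg by (metis abs_le_square_iff abs_of_nonneg mult_nonneg_nonneg)
qed

lemma nrm_triangle:
  assumes f: "f \<in> L2_per" and g: "g \<in> L2_per"
  shows "nrm (\<lambda>x. f x + g x) \<le> nrm f + nrm g"
proof -
  have "(nrm (\<lambda>x. f x + g x))\<^sup>2 = ip f f + 2 * ip f g + ip g g"
    using f g by (simp add: nrm_square ip_add_left ip_add_right L2_add ip_sym[of g f])
  also have "\<dots> \<le> (nrm f + nrm g)\<^sup>2"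
    using Cauchy_Schwarz_ip[OF f g] by (simp add: power2_sum nrm_square)
  finally show ?thesis
    using nrm_nonneg by (meson add_nonneg_nonneg power2_le_imp_le)
qed

lemma sup_nrm_upper:
  assumes "cont_per c" "x \<in> {0..2*pi}"
  shows "\<bar>c x\<bar> \<le> sup_nrm c"
proof -
  have "continuous_on {0..2*pi} (\<lambda>x. \<bar>c x\<bar>)"
    using assms(1) continuous_on_subset by (blast intro: continuous_intros)
  then have "bdd_above ((\<lambda>x. \<bar>c x\<bar>) ` {0..2*pi})"
    by (intro compact_imp_bounded[THEN bounded_imp_bdd_above] compact_continuous_image) auto
  then show ?thesis unfolding sup_nrm_def using assms(2) by (rule cSUP_upper2) simp
qed

lemma sup_nrm_nonneg: "cont_per c \<Longrightarrow> 0 \<le> sup_nrm c"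
  using sup_nrm_upper[of c 0] by (meson abs_ge_zero atLeastAtMost_iff order_refl order_trans pi_ge_zero mult_nonneg_nonneg zero_le_numeral)

lemma cont_per_mult: "cont_per f \<Longrightarrow> cont_per g \<Longrightarrow> cont_per (\<lambda>x. f x * g x)"
  by (auto simp: periodic_def intro: continuous_intros)

lemma cont_per_add: "cont_per f \<Longrightarrow> cont_per g \<Longrightarrow> cont_per (\<lambda>x. f x + g x)"
  by (auto simp: periodic_def intro: continuous_intros)

lemma cont_per_diff: "cont_per f \<Longrightarrow> cont_per g \<Longrightarrow> cont_per (\<lambda>x. f x - g x)"
  by (auto simp: periodic_def intro: continuous_intros)

lemma cont_per_scale: "cont_per f \<Longrightarrow> cont_per (\<lambda>x. c * f x)"
  by (auto simp: periodic_def intro: continuous_intros)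

lemma nrm_mult_le:
  assumes "cont_per c" "cont_per f"
  shows "nrm (\<lambda>x. c x * f x) \<le> sup_nrm c * nrm f"
proof -
  have "(nrm (\<lambda>x. c x * f x))\<^sup>2 = (LINT x:{0..2*pi}|lebesgue. (c x * f x)\<^sup>2)"
    unfolding nrm_square ip_def by (simp add: power2_eq_square)
  also have "\<dots> \<le> (LINT x:{0..2*pi}|lebesgue. (sup_nrm c)\<^sup>2 * (f x)\<^sup>2)"
  proof (rule set_integral_mono)
    show "set_integrable lebesgue {0..2*pi} (\<lambda>x. (c x * f x)\<^sup>2)"
      using L2_mult_integrable[OF cont_per_L2 cont_per_L2, OF cont_per_mult cont_per_mult, OF assms assms]
      by (simp add: power2_eq_square)
    show "set_integrable lebesgue {0..2*pi} (\<lambda>x. (sup_nrm c)\<^sup>2 * (f x)\<^sup>2)"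
      using L2_mult_integrable[OF cont_per_L2 cont_per_L2, OF assms(2) assms(2)]
      by (simp add: power2_eq_square)
    show "(c x * f x)\<^sup>2 \<le> (sup_nrm c)\<^sup>2 * (f x)\<^sup>2" if "x \<in> {0..2*pi}" for x
      using sup_nrm_upper[OF assms(1) that]
      using power_mono[of "\<bar>c x\<bar>" _ 2] by (simp add: power_mult_distrib mult_right_mono)
  qed
  also have "\<dots> = (sup_nrm c * nrm f)\<^sup>2"
    unfolding power_mult_distrib nrm_square ip_def by (simp add: power2_eq_square)
  finally show ?thesis
    using nrm_nonneg sup_nrm_nonneg[OF assms(1)] by (meson mult_nonneg_nonneg power2_le_imp_le)
qed

lemma ip_mult_bound:
  assumes "cont_per c" "cont_per f" "cont_per g"
  shows "\<bar>ip (\<lambda>x. c x * f x) g\<bar> \<le> sup_nrm c * nrm f * nrm g"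
proof -
  have "\<bar>ip (\<lambda>x. c x * f x) g\<bar> \<le> nrm (\<lambda>x. c x * f x) * nrm g"
    using assms by (intro Cauchy_Schwarz_ip cont_per_L2 cont_per_mult)
  also have "\<dots> \<le> sup_nrm c * nrm f * nrm g"
    using nrm_mult_le[OF assms(1,2)] nrm_nonneg by (intro mult_right_mono)
  finally show ?thesis .
qed

section \<open>Integration by parts and weak derivatives\<close>

lemma deriv_imp_continuous_on:
  fixes f :: "real \<Rightarrow> real"
  assumes "\<And>x. (f has_real_derivative f' x) (at x)"
  shows "continuous_on UNIV f"
  using assms by (meson DERIV_isCont continuous_at_imp_continuous_on)

lemma integral_deriv_periodic:
  assumes "\<And>x. (f has_real_derivative f' x) (at x)" "periodic f" "continuous_on UNIV f'"
  shows "(LINT x:{0..2*pi}|lebesgue. f' x) = 0"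
proof -
  have "(f' has_integral (f (2*pi) - f 0)) {0..2*pi}"
    using assms(1) by (intro fundamental_theorem_of_calculus)
      (auto simp flip: has_real_derivative_iff_has_vector_derivative intro: has_field_derivative_at_within)
  moreover have "f (2*pi) = f 0"
    using assms(2) unfolding periodic_def by (metis add_0)
  moreover have "set_integrable lebesgue {0..2*pi} f'"
    using assms(3) by (meson absolutely_integrable_continuous_real continuous_on_subset subset_UNIV)
  ultimately show ?thesis
    by (simp add: set_lebesgue_integral_eq_integral(2) integral_unique)
qed

lemma ip_by_parts:
  assumes "\<And>x. (f has_real_derivative f' x) (at x)" "\<And>x. (g has_real_derivative g' x) (at x)"
    and "periodic f" "periodic g" "cont_per f'" "cont_per g'"
  shows "ip f' g = - ip f g'"
proof -
  have cf: "cont_per f" "cont_per g"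
    using assms deriv_imp_continuous_on by blast+
  have "ip f' g + ip f g' = (LINT x:{0..2*pi}|lebesgue. f' x * g x + f x * g' x)"
    unfolding ip_def using cf assms
    by (subst set_integral_add) (auto intro!: L2_mult_integrable cont_per_L2)
  also have "\<dots> = 0"
  proof (rule integral_deriv_periodic[of "\<lambda>x. f x * g x"])
    show "((\<lambda>x. f x * g x) has_real_derivative f' x * g x + f x * g' x) (at x)" for x
      using assms(1)[of x] assms(2)[of x] by (auto intro!: derivative_eq_intros)
    show "continuous_on UNIV (\<lambda>x. f' x * g x + f x * g' x)"
      using cf assms by (intro continuous_intros) auto
  qed (use assms in \<open>auto simp: periodic_def\<close>)
  finally show ?thesis by simp
qed

lemma smooth_per_deriv:
  assumes "smooth_per \<psi>"
  shows "((deriv ^^ j) \<psi> has_real_derivative (deriv ^^ Suc j) \<psi> x) (at x)"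
  using assms by (simp add: smooth_per_def DERIV_deriv_iff_real_differentiable)

lemma smooth_per_cont_per:
  assumes "smooth_per \<psi>"
  shows "cont_per ((deriv ^^ j) \<psi>)"
proof -
  have "periodic ((deriv ^^ j) \<psi>)"
  proof (induction j)
    case 0
    then show ?case using assms by (simp add: smooth_per_def)
  next
    case (Suc j)
    let ?h = "(deriv ^^ j) \<psi>"
    have "deriv (\<lambda>y. ?h (y + 2*pi)) x = deriv ?h (x + 2*pi)" for x
      using smooth_per_deriv[OF assms, of j "x + 2*pi"]
      by (intro DERIV_imp_deriv) (simp add: DERIV_shift)
    moreover have "(\<lambda>y. ?h (y + 2*pi)) = ?h"
      using Suc by (auto simp: periodic_def)
    ultimately show ?case by (simp add: periodic_def)
  qed
  then show ?thesis
    using deriv_imp_continuous_on[OF smooth_per_deriv[OF assms]] by blast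
qed

text \<open>A family \<open>F\<close> stands for \<open>f, f', f'', \<dots>\<close>, so that a product can be treated by writing out its
  derivatives. One derivative at a time is moved from the test function to \<open>F\<close>.\<close>

lemma has_weak_deriv_classical:
  assumes "\<And>j x. j < k \<Longrightarrow> (F j has_real_derivative F (Suc j) x) (at x)"
    and "\<And>j. j \<le> k \<Longrightarrow> cont_per (F j)"
  shows "has_weak_deriv k (F 0) (F k)"
proof -
  have main: "ip (F i) ((deriv ^^ (k - i)) \<psi>) = (- 1) ^ (k - i) * ip (F k) \<psi>"
    if "i \<le> k" "smooth_per \<psi>" for i \<psi>
    using that(1)
  proof (induction i rule: inc_induct)
    case base
    then show ?case by simp
  next
    case (step i)
    have "ip (F (Suc i)) ((deriv ^^ (k - Suc i)) \<psi>) = - ip (F i) ((deriv ^^ Suc (k - Suc i)) \<psi>)"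
      using step.hyps assms by (intro ip_by_parts smooth_per_deriv smooth_per_cont_per smooth_per_cont_per[THEN conjunct1] that(2)) auto
    moreover have "Suc (k - Suc i) = k - i" using step.hyps by simp
    ultimately have "ip (F i) ((deriv ^^ (k - i)) \<psi>) = - ((- 1) ^ (k - Suc i) * ip (F k) \<psi>)"
      using step.IH by simp
    also have "\<dots> = (- 1) ^ (k - i) * ip (F k) \<psi>"
      by (simp flip: \<open>Suc (k - Suc i) = k - i\<close>)
    finally show ?case .
  qed
  show ?thesis
    unfolding has_weak_deriv_def
    using main[of 0] assms(2)[of k] cont_per_L2 by auto
qed

section \<open>Trigonometric sums\<close>

lemma integral_cos_int:
  fixes m :: int
  shows "(LINT x:{0..2*pi}|lebesgue. cos (of_int m * x + \<theta>)) = (if m = 0 then 2 * pi * cos \<theta> else 0)"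
proof (cases "m = 0")
  case True
  have "(LINT x:{0..2*pi}|lebesgue. cos \<theta>) = integral {0..2*pi} (\<lambda>x. cos \<theta>)"
    by (intro set_lebesgue_integral_eq_integral absolutely_integrable_continuous_real continuous_intros)
  then show ?thesis using True by simp
next
  case False
  have "(LINT x:{0..2*pi}|lebesgue. cos (of_int m * x + \<theta>)) = 0"
  proof (rule integral_deriv_periodic[of "\<lambda>x. sin (of_int m * x + \<theta>) / of_int m"])
    show "((\<lambda>x. sin (of_int m * x + \<theta>) / of_int m) has_real_derivative cos (of_int m * x + \<theta>)) (at x)" for x
      using False by (auto intro!: derivative_eq_intros simp: field_simps)
    have "sin (of_int m * (x + 2*pi) + \<theta>) = sin (of_int m * x + \<theta>)" for x
    proof -
      have e: "of_int m * (x + 2*pi) + \<theta> = (of_int m * x + \<theta>) + 2 * pi * of_int m" by (simp add: algebra_simps)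
      show ?thesis unfolding e sin_add by simp
    qed
    then show "periodic (\<lambda>x. sin (of_int m * x + \<theta>) / of_int m)"
      by (simp add: periodic_def)
  qed (auto intro!: continuous_intros)
  then show ?thesis using False by simp
qed

lemma cos_int_cont_per:
  fixes m :: int
  shows "cont_per (\<lambda>x. cos (of_int m * x + \<theta>))"
proof -
  have "cos (of_int m * (x + 2*pi) + \<theta>) = cos (of_int m * x + \<theta>)" for x
  proof -
    have e: "of_int m * (x + 2*pi) + \<theta> = (of_int m * x + \<theta>) + 2 * pi * of_int m" by (simp add: algebra_simps)
    show ?thesis unfolding e cos_add by simp
  qed
  then show ?thesis by (auto simp: periodic_def intro!: continuous_intros)
qed

lemma sin_as_cos: "sin (y::real) = cos (y - pi/2)"
  by (simp add: cos_diff)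

lemma cont_per_cos_phase: "cont_per (\<lambda>x. cos (real k * x + \<theta>))"
  using cos_int_cont_per[of "int k" \<theta>] by simp

lemma cont_per_sin_phase: "cont_per (\<lambda>x. sin (real k * x + \<theta>))"
  using cont_per_cos_phase[of k "\<theta> - pi/2"] by (simp add: sin_as_cos algebra_simps)

text \<open>The phases \<open>\<alpha>\<close> and \<open>\<beta>\<close> make this one formula cover all products of sines and cosines,
  since a sine is a cosine shifted by \<open>\<pi>/2\<close>.\<close>

lemma ip_cos_cos:
  assumes "1 \<le> k"
  shows "ip (\<lambda>x. cos (real j * x + \<alpha>)) (\<lambda>x. cos (real k * x + \<beta>)) = (if j = k then pi * cos (\<alpha> - \<beta>) else 0)"
proof -
  have "cos (real j * x + \<alpha>) * cos (real k * x + \<beta>) =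
     1/2 * cos (of_int (int j - int k) * x + (\<alpha> - \<beta>)) + 1/2 * cos (of_int (int j + int k) * x + (\<alpha> + \<beta>))" for x
  proof -
    have "cos (real j * x + \<alpha>) * cos (real k * x + \<beta>) = (cos ((real j * x + \<alpha>) - (real k * x + \<beta>)) + cos ((real j * x + \<alpha>) + (real k * x + \<beta>))) / 2"
      by (rule cos_times_cos)
    then show ?thesis by (simp add: algebra_simps)
  qed
  then have "ip (\<lambda>x. cos (real j * x + \<alpha>)) (\<lambda>x. cos (real k * x + \<beta>)) =
    (LINT x:{0..2*pi}|lebesgue. 1/2 * cos (of_int (int j - int k) * x + (\<alpha> - \<beta>)) + 1/2 * cos (of_int (int j + int k) * x + (\<alpha> + \<beta>)))"
    by (simp add: ip_def)
  also have "\<dots> = (LINT x:{0..2*pi}|lebesgue. 1/2 * cos (of_int (int j - int k) * x + (\<alpha> - \<beta>))) + (LINT x:{0..2*pi}|lebesgue. 1/2 * cos (of_int (int j + int k) * x + (\<alpha> + \<beta>)))"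
    by (intro set_integral_add absolutely_integrable_continuous_real continuous_intros)
  also have "\<dots> = 1/2 * (if int j - int k = 0 then 2 * pi * cos (\<alpha> - \<beta>) else 0) + 1/2 * (if int j + int k = 0 then 2 * pi * cos (\<alpha> + \<beta>) else 0)"
    unfolding set_integral_mult_right integral_cos_int ..
  also have "\<dots> = (if j = k then pi * cos (\<alpha> - \<beta>) else 0)"
    using assms by auto
  finally show ?thesis .
qed

text \<open>The \<open>j\<close>-th derivative of the trigonometric polynomial with cosine coefficients \<open>a\<close> and sine
  coefficients \<open>b\<close>: differentiating a mode of frequency \<open>k\<close> multiplies it by \<open>k\<close> and advances its phase
  by \<open>\<pi>/2\<close>. All derivatives of a trigonometric polynomial thus share the same coefficients.\<close>

definition trig_sum :: "nat \<Rightarrow> nat \<Rightarrow> (nat \<Rightarrow> real) \<Rightarrow> (nat \<Rightarrow> real) \<Rightarrow> real \<Rightarrow> real" where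
  "trig_sum j N a b x = (\<Sum>k=1..N. real k ^ j *
     (a k * cos (real k * x + real j * (pi/2)) + b k * sin (real k * x + real j * (pi/2))))"

lemma H_fin_iff: "f \<in> H_fin N \<longleftrightarrow> (\<exists>a b. f = trig_sum 0 N a b)"
proof -
  have "trig_sum 0 N a b = (\<lambda>x. \<Sum>k=1..N. a k * cos (real k * x) + b k * sin (real k * x))" for a b
    by (simp add: trig_sum_def fun_eq_iff)
  then show ?thesis by (simp add: H_fin_def)
qed

lemma trig_sum_deriv: "(trig_sum j N a b has_real_derivative trig_sum (Suc j) N a b x) (at x)"
proof -
  have "((\<lambda>x. \<Sum>k=1..N. real k ^ j * (a k * cos (real k * x + real j * (pi/2)) + b k * sin (real k * x + real j * (pi/2))))
    has_real_derivative trig_sum (Suc j) N a b x) (at x)"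
    unfolding trig_sum_def
  proof (rule DERIV_sum)
    fix k
    define y where "y = real k * x + real j * (pi/2)"
    have y: "real k * x + real (Suc j) * (pi/2) = y + pi/2"
      by (simp add: y_def field_simps)
    have "((\<lambda>x. real k ^ j * (a k * cos (real k * x + real j * (pi/2)) + b k * sin (real k * x + real j * (pi/2))))
      has_real_derivative real k ^ j * (a k * (- sin y * real k) + b k * (cos y * real k))) (at x)"
      unfolding y_def by (auto intro!: derivative_eq_intros)
    moreover have "real k ^ j * (a k * (- sin y * real k) + b k * (cos y * real k))
       = real k ^ Suc j * (a k * cos (y + pi/2) + b k * sin (y + pi/2))"
      by (simp add: cos_add sin_add algebra_simps)
    ultimately show "((\<lambda>x. real k ^ j * (a k * cos (real k * x + real j * (pi/2)) + b k * sin (real k * x + real j * (pi/2))))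
      has_real_derivative real k ^ Suc j * (a k * cos (real k * x + real (Suc j) * (pi/2)) + b k * sin (real k * x + real (Suc j) * (pi/2)))) (at x)"
      by (simp only: y)
  qed
  then show ?thesis by (simp add: trig_sum_def[abs_def])
qed

lemma cont_per_sum: "(\<And>k. k \<in> A \<Longrightarrow> cont_per (f k)) \<Longrightarrow> cont_per (\<lambda>x. \<Sum>k\<in>A. f k x)"
  by (auto simp: periodic_def intro: continuous_intros)

lemma trig_sum_cont_per: "cont_per (trig_sum j N a b)"
  unfolding trig_sum_def[abs_def]
  by (intro cont_per_sum cont_per_scale cont_per_add cont_per_cos_phase cont_per_sin_phase)

lemma trig_sum_L2: "trig_sum j N a b \<in> L2_per"
  by (intro cont_per_L2 trig_sum_cont_per)

lemma deriv_trig_sum: "deriv (trig_sum j N a b) = trig_sum (Suc j) N a b"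
  using trig_sum_deriv DERIV_imp_deriv by blast

lemma funpow_deriv_trig_sum: "(deriv ^^ i) (trig_sum j N a b) = trig_sum (i + j) N a b"
  by (induction i) (simp_all add: deriv_trig_sum)

lemma trig_sum_smooth_per: "smooth_per (trig_sum j N a b)"
  unfolding smooth_per_def funpow_deriv_trig_sum real_differentiable_def
  using trig_sum_cont_per trig_sum_deriv by blast

lemma L2_sum:
  assumes "finite A" "\<And>k. k \<in> A \<Longrightarrow> f k \<in> L2_per"
  shows "(\<lambda>x. \<Sum>k\<in>A. f k x) \<in> L2_per"
  using assms
proof (induction A rule: finite_induct)
  case empty
  have "cont_per (\<lambda>x. 0)" by (simp add: periodic_def)
  then show ?case using cont_per_L2 by simp
next
  case (insert k A)
  then show ?case by (simp add: L2_add)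
qed

lemma ip_sum_right:
  assumes "f \<in> L2_per" "finite A" "\<And>k. k \<in> A \<Longrightarrow> g k \<in> L2_per"
  shows "ip f (\<lambda>x. \<Sum>k\<in>A. g k x) = (\<Sum>k\<in>A. ip f (g k))"
  using assms(2,3)
proof (induction A rule: finite_induct)
  case empty
  then show ?case by (simp add: ip_def)
next
  case (insert k A)
  then show ?case using assms(1) by (simp add: ip_add_right L2_sum)
qed

lemma ip_trig_sum_right:
  assumes "f \<in> L2_per"
  shows "ip f (trig_sum j N c d) = (\<Sum>k=1..N. real k ^ j *
     (c k * ip f (\<lambda>x. cos (real k * x + real j * (pi/2))) + d k * ip f (\<lambda>x. sin (real k * x + real j * (pi/2)))))"
proof -
  have L: "(\<lambda>x. cos (real k * x + \<theta>)) \<in> L2_per" "(\<lambda>x. sin (real k * x + \<theta>)) \<in> L2_per" for k \<theta>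
    by (intro cont_per_L2 cont_per_cos_phase cont_per_sin_phase)+
  show ?thesis
    unfolding trig_sum_def[abs_def]
    by (subst ip_sum_right) (simp_all add: assms L L2_scale L2_add ip_scale_right ip_add_right)
qed

lemma ip_trig_sum_cos:
  assumes "m \<in> {1..N}"
  shows "ip (trig_sum j N a b) (\<lambda>x. cos (real m * x + real j * (pi/2))) = real m ^ j * (pi * a m)"
proof -
  have L: "(\<lambda>x. cos (real k * x + \<theta>)) \<in> L2_per" for k \<theta>
    by (intro cont_per_L2 cont_per_cos_phase)
  have "ip (trig_sum j N a b) (\<lambda>x. cos (real m * x + real j * (pi/2))) =
     ip (\<lambda>x. cos (real m * x + real j * (pi/2))) (trig_sum j N a b)"
    by (rule ip_sym)
  also have "\<dots> = (\<Sum>k=1..N. real k ^ j * (if m = k then pi * a k else 0))"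
    unfolding ip_trig_sum_right[OF L]
  proof (rule sum.cong)
    fix k assume "k \<in> {1..N}"
    then have "1 \<le> k" by simp
    then show "real k ^ j * (a k * ip (\<lambda>x. cos (real m * x + real j * (pi/2))) (\<lambda>x. cos (real k * x + real j * (pi/2))) +
       b k * ip (\<lambda>x. cos (real m * x + real j * (pi/2))) (\<lambda>x. sin (real k * x + real j * (pi/2)))) =
       real k ^ j * (if m = k then pi * a k else 0)"
      using ip_cos_cos[of k m "real j * (pi/2)" "real j * (pi/2)"]
        ip_cos_cos[of k m "real j * (pi/2)" "real j * (pi/2) - pi/2"]
      by (simp add: sin_as_cos[of "_ + _"] add_diff_eq)
  qed simp
  also have "\<dots> = (\<Sum>k=1..N. if m = k then real k ^ j * (pi * a k) else 0)"
    by (intro sum.cong) auto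
  also have "\<dots> = real m ^ j * (pi * a m)" using assms by simp
  finally show ?thesis .
qed

lemma ip_trig_sum_sin:
  assumes "m \<in> {1..N}"
  shows "ip (trig_sum j N a b) (\<lambda>x. sin (real m * x + real j * (pi/2))) = real m ^ j * (pi * b m)"
proof -
  have L: "(\<lambda>x. sin (real k * x + \<theta>)) \<in> L2_per" for k \<theta>
    by (intro cont_per_L2 cont_per_sin_phase)
  have "ip (trig_sum j N a b) (\<lambda>x. sin (real m * x + real j * (pi/2))) =
     ip (\<lambda>x. sin (real m * x + real j * (pi/2))) (trig_sum j N a b)"
    by (rule ip_sym)
  also have "\<dots> = (\<Sum>k=1..N. real k ^ j * (if m = k then pi * b k else 0))"
    unfolding ip_trig_sum_right[OF L]
  proof (rule sum.cong)
    fix k assume "k \<in> {1..N}"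
    then have "1 \<le> k" by simp
    then show "real k ^ j * (a k * ip (\<lambda>x. sin (real m * x + real j * (pi/2))) (\<lambda>x. cos (real k * x + real j * (pi/2))) +
       b k * ip (\<lambda>x. sin (real m * x + real j * (pi/2))) (\<lambda>x. sin (real k * x + real j * (pi/2)))) =
       real k ^ j * (if m = k then pi * b k else 0)"
      using ip_cos_cos[of k m "real j * (pi/2) - pi/2" "real j * (pi/2)"]
        ip_cos_cos[of k m "real j * (pi/2) - pi/2" "real j * (pi/2) - pi/2"]
      by (simp add: sin_as_cos[of "_ + _"] add_diff_eq)
  qed simp
  also have "\<dots> = (\<Sum>k=1..N. if m = k then real k ^ j * (pi * b k) else 0)"
    by (intro sum.cong) auto
  also have "\<dots> = real m ^ j * (pi * b m)" using assms by simp
  finally show ?thesis .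
qed

lemma ip_trig_sum_trig_sum:
  "ip (trig_sum j N a b) (trig_sum j N c d) = pi * (\<Sum>k=1..N. real k ^ (2*j) * (a k * c k + b k * d k))"
proof -
  have "ip (trig_sum j N a b) (trig_sum j N c d) = (\<Sum>k=1..N. real k ^ j *
     (c k * (real k ^ j * (pi * a k)) + d k * (real k ^ j * (pi * b k))))"
    unfolding ip_trig_sum_right[OF trig_sum_L2] by (intro sum.cong) (simp_all only: ip_trig_sum_cos ip_trig_sum_sin)
  also have "\<dots> = (\<Sum>k=1..N. pi * (real k ^ (2*j) * (a k * c k + b k * d k)))"
    unfolding power_even_eq power2_eq_square by (intro sum.cong) (simp_all add: algebra_simps)
  finally show ?thesis by (simp add: sum_distrib_left)
qed

lemma nrm_trig_sum_sq:
  "(nrm (trig_sum j N a b))\<^sup>2 = pi * (\<Sum>k=1..N. real k ^ (2*j) * ((a k)\<^sup>2 + (b k)\<^sup>2))"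
  unfolding nrm_square ip_trig_sum_trig_sum by (simp add: power2_eq_square)

section \<open>Completeness of the trigonometric system\<close>

lemma cos_int_phase_orth:
  fixes m :: int
  assumes h: "h \<in> L2_per"
    and c: "\<And>k::nat. ip h (\<lambda>x. cos (real k * x)) = 0" and s: "\<And>k::nat. ip h (\<lambda>x. sin (real k * x)) = 0"
  shows "ip h (\<lambda>x. cos (of_int m * x + \<theta>)) = 0"
proof -
  have L: "(\<lambda>x. cos (real k * x)) \<in> L2_per" "(\<lambda>x. sin (real k * x)) \<in> L2_per" for k
    using cont_per_L2[OF cont_per_cos_phase[of k 0]] cont_per_L2[OF cont_per_sin_phase[of k 0]] by simp_all
  obtain e :: real and k :: nat where e: "\<And>x. cos (of_int m * x + \<theta>) = cos \<theta> * cos (real k * x) + e * sin (real k * x)"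
  proof (cases m)
    case (nonneg k)
    then show ?thesis using that[of k "- sin \<theta>"] by (simp add: cos_add mult.commute)
  next
    case (neg k)
    then have m: "real_of_int m = - real (Suc k)" by simp
    have "of_int m * x + \<theta> = \<theta> - real (Suc k) * x" for x
      unfolding m by (simp add: algebra_simps)
    then have "cos (of_int m * x + \<theta>) = cos \<theta> * cos (real (Suc k) * x) + sin \<theta> * sin (real (Suc k) * x)" for x
      by (simp only: cos_diff)
    then show ?thesis by (rule that)
  qed
  show ?thesis
    unfolding e using h by (simp add: ip_add_right ip_scale_right L L2_scale c s)
qed

text \<open>Orthogonality to all modes does not pass from two polynomials on the circle to their product.
  The induction therefore shows that multiplication by \<open>p\<close> preserves the functions \<open>f\<close> for which
  \<open>h f\<close> is orthogonal to all modes: for linear \<open>p\<close>, multiplication by \<open>cos x\<close> or \<open>sin x\<close> shifts the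
  frequency \<open>m\<close> by \<open>1\<close> in both directions, which is why \<open>m\<close> ranges over the integers.\<close>

lemma polynomial_circle_orth:
  fixes h :: "real \<Rightarrow> real" and p :: "complex \<Rightarrow> real"
  assumes h: "h \<in> L2_per"
    and p: "real_polynomial_function p"
    and "cont_per f" and "\<And>(m::int) \<theta>. ip h (\<lambda>x. f x * cos (of_int m * x + \<theta>)) = 0"
  shows "cont_per (\<lambda>x. p (cis x) * f x) \<and> ip h (\<lambda>x. p (cis x) * f x * cos (of_int m * x + \<theta>)) = 0"
  using p assms(3,4)
proof (induction p arbitrary: f m \<theta> rule: real_polynomial_function.induct)
  case (linear p)
  note f = linear.prems
  interpret bounded_linear p by fact
  have pe: "p (cis x) = p 1 * cos x + p \<i> * sin x" for x
  proof -
    have "cis x = cos x *\<^sub>R 1 + sin x *\<^sub>R \<i>" by (simp add: complex_eq_iff)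
    then show ?thesis by (metis add scaleR mult.commute real_scaleR_def)
  qed
  have cp: "cont_per (\<lambda>x. f x * cos (of_int k * x + t))" for k :: int and t
    using f(1) cos_int_cont_per by (intro cont_per_mult) auto
  have e: "p (cis x) * f x * cos (of_int m * x + \<theta>) =
     (p 1 / 2) * (f x * cos (of_int (m+1) * x + \<theta>)) + (p 1 / 2) * (f x * cos (of_int (m-1) * x + \<theta>)) +
     ((p \<i> / 2) * (f x * cos (of_int (m+1) * x + (\<theta> - pi/2))) + (- p \<i> / 2) * (f x * cos (of_int (m-1) * x + (\<theta> - pi/2))))" for x
  proof -
    define y where "y = of_int m * x + \<theta>"
    have y: "of_int (m+1) * x + \<theta> = y + x" "of_int (m-1) * x + \<theta> = y - x"
       "of_int (m+1) * x + (\<theta> - pi/2) = y + x - pi/2" "of_int (m-1) * x + (\<theta> - pi/2) = y - x - pi/2"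
      by (simp_all add: y_def algebra_simps)
    show ?thesis unfolding pe y y_def[symmetric] sin_as_cos[symmetric]
      by (simp add: cos_add cos_diff sin_add sin_diff algebra_simps)
  qed
  have "ip h (\<lambda>x. p (cis x) * f x * cos (of_int m * x + \<theta>)) = 0"
    unfolding e using h f(2)
    by (simp only: ip_add_right ip_scale_right cont_per_L2 cont_per_add cont_per_scale cp)
  moreover have "cont_per (\<lambda>x. p (cis x) * f x)"
  proof (rule cont_per_mult)
    show "cont_per (\<lambda>x. p (cis x))"
      by (auto simp: periodic_def pe intro!: continuous_intros)
  qed (use f(1) in auto)
  ultimately show ?case by blast
next
  case (const c)
  then show ?case by (simp add: cont_per_scale ip_scale_right mult.assoc)
next
  case (add p q)
  have P: "cont_per (\<lambda>x. p (cis x) * f x)" "ip h (\<lambda>x. p (cis x) * f x * cos (of_int m * x + \<theta>)) = 0"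
    and Q: "cont_per (\<lambda>x. q (cis x) * f x)" "ip h (\<lambda>x. q (cis x) * f x * cos (of_int m * x + \<theta>)) = 0"
    using add by blast+
  show ?case
    unfolding distrib_right
    using P Q h cos_int_cont_per[of m \<theta>]
    by (auto simp: cont_per_add cont_per_L2 cont_per_mult ip_add_right)
next
  case (mult p q)
  have Q: "cont_per (\<lambda>x. q (cis x) * f x)" "\<And>(m::int) \<theta>. ip h (\<lambda>x. q (cis x) * f x * cos (of_int m * x + \<theta>)) = 0"
    using mult.IH(2)[OF mult.prems] by blast+
  show ?case
    using mult.IH(1)[OF Q, of m \<theta>] by (simp add: mult.assoc)
qed

lemma cont_per_circle:
  assumes "continuous_on UNIV F"
  shows "cont_per (\<lambda>x. F (cis x))"
proof -
  have "continuous_on UNIV cis"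
    using continuous_on_cis[OF continuous_on_id] by simp
  then have "continuous_on UNIV (\<lambda>x. F (cis x))"
    using continuous_on_compose2[OF assms] by blast
  then show ?thesis by (simp add: periodic_def flip: cis_mult)
qed

text \<open>By the Stone-Weierstrass theorem, polynomials are uniformly dense in the continuous functions
  on the unit circle.\<close>

lemma continuous_circle_orth:
  fixes h :: "real \<Rightarrow> real" and F :: "complex \<Rightarrow> real"
  assumes h: "h \<in> L2_per"
    and c: "\<And>k::nat. ip h (\<lambda>x. cos (real k * x)) = 0" and s: "\<And>k::nat. ip h (\<lambda>x. sin (real k * x)) = 0"
    and F: "continuous_on UNIV F"
  shows "ip h (\<lambda>x. F (cis x)) = 0"
proof -
  have cF: "cont_per (\<lambda>x. F (cis x))"
    using F by (rule cont_per_circle)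
  have one: "cont_per (\<lambda>x. 1)" by (simp add: periodic_def)
  have "\<bar>ip h (\<lambda>x. F (cis x))\<bar> \<le> e * (nrm h * nrm (\<lambda>x. 1))" if "e > 0" for e
  proof -
    obtain p where p: "real_polynomial_function p" "\<And>z. z \<in> sphere 0 1 \<Longrightarrow> \<bar>F z - p z\<bar> < e"
      using Stone_Weierstrass_real_polynomial_function[of "sphere 0 1" F e] F \<open>e > 0\<close>
        continuous_on_subset by (metis compact_sphere subset_UNIV)
    have P: "cont_per (\<lambda>x. p (cis x))" "ip h (\<lambda>x. p (cis x)) = 0"
      using polynomial_circle_orth[OF h p(1) one, of 0 0] cos_int_phase_orth[OF h c s] by simp_all
    define d where "d x = F (cis x) - p (cis x)" for x
    have cd: "cont_per d"
      unfolding d_def using cont_per_add[OF cF cont_per_scale[OF P(1), of "-1"]] by simp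
    have sd: "sup_nrm d \<le> e"
      unfolding sup_nrm_def
    proof (rule cSUP_least)
      show "\<bar>d x\<bar> \<le> e" for x using p(2)[of "cis x"] by (simp add: d_def less_imp_le)
    qed auto
    have "ip h (\<lambda>x. F (cis x)) = ip h d"
      unfolding d_def using h cF P cont_per_L2 by (subst ip_diff_right) auto
    also have "\<bar>ip h d\<bar> \<le> nrm h * nrm d"
      using h cd cont_per_L2 by (intro Cauchy_Schwarz_ip)
    also have "\<dots> \<le> nrm h * (sup_nrm d * nrm (\<lambda>x. 1))"
      using nrm_mult_le[OF cd one] nrm_nonneg by (intro mult_left_mono) auto
    also have "\<dots> \<le> nrm h * (e * nrm (\<lambda>x. 1))"
      using sd nrm_nonneg by (intro mult_left_mono mult_right_mono)
    finally show ?thesis by (simp add: mult_ac)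
  qed
  then have le: "\<bar>ip h (\<lambda>x. F (cis x))\<bar> \<le> e * (nrm h * nrm (\<lambda>x. 1))" if "e > 0" for e
    using that by blast
  have "((\<lambda>e. e * (nrm h * nrm (\<lambda>x. 1))) \<longlongrightarrow> 0 * (nrm h * nrm (\<lambda>x. 1))) (at_right 0)"
    by (intro tendsto_intros)
  then have "\<bar>ip h (\<lambda>x. F (cis x))\<bar> \<le> 0 * (nrm h * nrm (\<lambda>x. 1))"
    by (rule tendsto_lowerbound) (auto simp: eventually_at_right_less eventually_at_filter le)
  then show ?thesis by simp
qed

text \<open>The indicator function of an interval is a pointwise limit of continuous functions on the circle
  with values in \<open>[0,1]\<close>: an interval with midpoint \<open>c\<close> and radius \<open>r\<close> is the arc on which
  \<open>cos (x - c) > cos r\<close>, and the approximations cut \<open>m (cos (x - c) - cos r)\<close> off at \<open>0\<close> and \<open>1\<close>.\<close>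

lemma interval_integral_zero:
  fixes h :: "real \<Rightarrow> real"
  assumes h: "h \<in> L2_per"
    and orth: "\<And>F :: complex \<Rightarrow> real. continuous_on UNIV F \<Longrightarrow> ip h (\<lambda>x. F (cis x)) = 0"
    and ab: "0 \<le> a" "a < b" "b \<le> 2*pi"
  shows "integral {a..b} h = 0"
proof -
  define I where "I = {0..2*pi}"
  define c r where "c = (a + b) / 2" and "r = (b - a) / 2"
  have one: "(\<lambda>x. 1) \<in> L2_per" by (intro cont_per_L2) (simp add: periodic_def)
  have hint: "set_integrable lebesgue I h"
    using L2_mult_integrable[OF h one] by (simp add: I_def)
  define F :: "nat \<Rightarrow> complex \<Rightarrow> real" where
    "F m z = max 0 (min 1 (real m * (Re (z * cnj (cis c)) - cos r)))" for m z
  have Fcis: "F m (cis x) = max 0 (min 1 (real m * (cos (x - c) - cos r)))" for m x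
    by (simp add: F_def cos_diff)
  have arc: "cos (x - c) > cos r \<longleftrightarrow> x \<in> {a<..<b}" if "x \<in> I" for x
  proof -
    have r: "0 \<le> r" "r \<le> pi" and x: "\<bar>x - c\<bar> \<le> 2*pi - r"
      using ab that by (auto simp: r_def c_def I_def abs_le_iff field_simps)
    have "cos (x - c) > cos r \<longleftrightarrow> \<bar>x - c\<bar> < r"
    proof (cases "\<bar>x - c\<bar> \<le> pi")
      case True
      then have "cos r < cos \<bar>x - c\<bar> \<longleftrightarrow> \<bar>x - c\<bar> < r"
        using r by (intro cos_mono_less_eq) auto
      then show ?thesis by simp
    next
      case False
      have "cos (x - c) = cos (2*pi - \<bar>x - c\<bar>)" by (simp add: cos_diff abs_if)
      also have "\<dots> \<le> cos r"
        using False x r by (intro cos_monotone_0_pi_le) auto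
      finally show ?thesis using False r by simp
    qed
    also have "\<dots> \<longleftrightarrow> x \<in> {a<..<b}"
      by (auto simp: r_def c_def abs_less_iff field_simps)
    finally show ?thesis .
  qed
  have meas: "(\<lambda>x. indicator I x *\<^sub>R (h x * F m (cis x))) \<in> borel_measurable lebesgue" for m
  proof -
    have "continuous_on UNIV (F m)" unfolding F_def by (intro continuous_intros)
    then have "cont_per (\<lambda>x. F m (cis x))" by (rule cont_per_circle)
    then show ?thesis
      using L2_mult_integrable[OF h cont_per_L2] by (simp add: set_integrable_def I_def)
  qed
  have "(\<lambda>m. LINT x|lebesgue. indicator I x *\<^sub>R (h x * F m (cis x))) \<longlonglongrightarrow>
      (LINT x|lebesgue. indicator {a<..<b} x *\<^sub>R h x)"
  proof (rule integral_dominated_convergence[where w = "\<lambda>x. \<bar>indicator I x *\<^sub>R h x\<bar>"])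
    show "integrable lebesgue (\<lambda>x. \<bar>indicator I x *\<^sub>R h x\<bar>)"
      using hint by (simp add: set_integrable_def)
    have "set_integrable lebesgue {a<..<b} h"
      using hint by (rule set_integrable_subset) (use ab in \<open>auto simp: I_def\<close>)
    then show "(\<lambda>x. indicator {a<..<b} x *\<^sub>R h x) \<in> borel_measurable lebesgue"
      by (simp add: set_integrable_def)
    show "AE x in lebesgue. (\<lambda>m. indicator I x *\<^sub>R (h x * F m (cis x))) \<longlonglongrightarrow> indicator {a<..<b} x *\<^sub>R h x"
    proof (rule AE_I2)
      fix x
      show "(\<lambda>m. indicator I x *\<^sub>R (h x * F m (cis x))) \<longlonglongrightarrow> indicator {a<..<b} x *\<^sub>R h x"
      proof (cases "x \<in> {a<..<b}")
        case True
        then have xI: "x \<in> I" using ab by (auto simp: I_def)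
        then have pos: "cos (x - c) - cos r > 0" using arc[OF xI] True by simp
        obtain M :: nat where M: "1 / (cos (x - c) - cos r) < real M" using reals_Archimedean2 by blast
        have "F m (cis x) = 1" if "m \<ge> M" for m
        proof -
          have "1 < real M * (cos (x - c) - cos r)" using M pos by (simp add: field_simps)
          also have "\<dots> \<le> real m * (cos (x - c) - cos r)" using that pos by (intro mult_right_mono) auto
          finally show ?thesis by (simp add: Fcis)
        qed
        then have "eventually (\<lambda>m. indicator I x *\<^sub>R (h x * F m (cis x)) = h x) sequentially"
          using xI by (auto simp: eventually_sequentially)
        then show ?thesis using True by (simp add: tendsto_eventually)
      next
        case False
        have "indicator I x *\<^sub>R (h x * F m (cis x)) = 0" for m
        proof (cases "x \<in> I")
          case True
          then have "\<not> cos (x - c) > cos r" using arc[OF True] False by blast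
          then have "real m * (cos (x - c) - cos r) \<le> 0" by (simp add: mult_nonneg_nonpos)
          then show ?thesis by (simp add: Fcis)
        qed simp
        then have "(\<lambda>m. indicator I x *\<^sub>R (h x * F m (cis x))) = (\<lambda>m. 0)" by (rule ext)
        moreover have "indicator {a<..<b} x = (0::real)" using False by (simp add: indicator_def)
        ultimately show ?thesis by (simp only: tendsto_const scaleR_zero_left)
      qed
    qed
    show "AE x in lebesgue. norm (indicator I x *\<^sub>R (h x * F m (cis x))) \<le> \<bar>indicator I x *\<^sub>R h x\<bar>" for m
    proof (rule AE_I2)
      fix x
      have "\<bar>F m (cis x)\<bar> \<le> 1" by (simp add: Fcis)
      then have "\<bar>h x * F m (cis x)\<bar> \<le> \<bar>h x\<bar>" by (simp add: abs_mult mult_left_le)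
      then show "norm (indicator I x *\<^sub>R (h x * F m (cis x))) \<le> \<bar>indicator I x *\<^sub>R h x\<bar>"
        by (simp add: indicator_def)
    qed
  qed (rule meas)
  moreover have "(LINT x|lebesgue. indicator I x *\<^sub>R (h x * F m (cis x))) = 0" for m
  proof -
    have "continuous_on UNIV (F m)" unfolding F_def by (intro continuous_intros)
    then show ?thesis using orth[of "F m"] by (simp add: ip_def set_lebesgue_integral_def I_def)
  qed
  ultimately have "(LINT x:{a<..<b}|lebesgue. h x) = 0"
    by (simp add: set_lebesgue_integral_def LIMSEQ_const_iff)
  moreover have "set_integrable lebesgue {a<..<b} h"
    using hint by (rule set_integrable_subset) (use ab in \<open>auto simp: I_def\<close>)
  ultimately have "integral {a<..<b} h = 0"
    by (simp add: set_lebesgue_integral_eq_integral(2))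
  then show ?thesis by (simp add: integral_open_interval_real)
qed

text \<open>A function with vanishing integrals over all intervals vanishes almost everywhere, because it is
  almost everywhere the limit of its averages over shrinking intervals. The conclusion is put in terms
  of scalar products, the form in which it is applied.\<close>

lemma trig_orth_imp_ip_zero:
  assumes h: "h \<in> L2_per"
    and c: "\<And>k::nat. ip h (\<lambda>x. cos (real k * x)) = 0" and s: "\<And>k::nat. ip h (\<lambda>x. sin (real k * x)) = 0"
  shows "ip h f = 0"
proof -
  define g where "g x = (if x \<in> {0..2*pi} then h x else 0)" for x
  have one: "(\<lambda>x. 1) \<in> L2_per" by (intro cont_per_L2) (simp add: periodic_def)
  have "set_integrable lebesgue {0..2*pi} h"
    using L2_mult_integrable[OF h one] by simp
  then have hint: "h integrable_on {0..2*pi}"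
    by (rule set_lebesgue_integral_eq_integral)
  then have gint: "g integrable_on UNIV"
    unfolding g_def[abs_def] by (simp only: integrable_restrict_UNIV)
  have gi: "g integrable_on cbox a b" for a b
    using integrable_on_subcbox[OF gint] by simp
  obtain N where N: "negligible N" "\<And>x e. \<lbrakk>x \<notin> N; 0 < e\<rbrakk> \<Longrightarrow> \<exists>d>0. \<forall>t. 0 < t \<and> t < d \<longrightarrow>
      norm (integral (cbox x (x + t *\<^sub>R One)) g /\<^sub>R t ^ DIM(real) - g x) < e"
    using integrable_ccontinuous_explicit[of g] gi by blast
  have zero: "h x = 0" if x: "x \<in> {0..2*pi}" "x \<notin> insert (2*pi) N" for x
  proof (rule ccontr)
    assume "h x \<noteq> 0"
    then obtain d where d: "d > 0" "\<And>t. 0 < t \<Longrightarrow> t < d \<Longrightarrow>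
       norm (integral (cbox x (x + t *\<^sub>R One)) g /\<^sub>R t ^ DIM(real) - g x) < \<bar>h x\<bar>"
      using N(2)[of x "\<bar>h x\<bar>"] x by auto
    \<comment> \<open>The average is taken to the right of \<open>x\<close>, hence the exclusion of \<open>2\<pi>\<close>.\<close>
    define t where "t = min (d/2) (2*pi - x)"
    have t: "0 < t" "t < d" "x + t \<le> 2*pi" using d x by (auto simp: t_def)
    have "integral {x..x+t} g = integral {x..x+t} h"
      by (rule integral_cong) (use x t in \<open>auto simp: g_def\<close>)
    also have "\<dots> = 0"
      using t x continuous_circle_orth[OF h c s] by (intro interval_integral_zero[OF h]) auto
    finally show False
      using d(2)[OF t(1,2)] x by (simp add: g_def)
  qed
  have "AE x in lebesgue. x \<notin> insert (2*pi) N"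
    using N(1) by (intro AE_not_in) (simp flip: negligible_iff_null_sets)
  then have "AE x in lebesgue. indicator {0..2*pi} x *\<^sub>R (h x * f x) = 0"
    by eventually_elim (use zero in \<open>auto simp: indicator_def\<close>)
  then show ?thesis
    unfolding ip_def set_lebesgue_integral_def by (rule integral_eq_zero_AE)
qed

section \<open>Fourier series of functions with a weak fourth derivative\<close>

lemma ip_weak_deriv_trig_sum:
  assumes "has_weak_deriv k f g"
  shows "ip g (trig_sum 0 N c d) = (-1) ^ k * ip f (trig_sum k N c d)"
proof -
  have "ip f ((deriv ^^ k) (trig_sum 0 N c d)) = (-1) ^ k * ip g (trig_sum 0 N c d)"
    using assms trig_sum_smooth_per by (simp add: has_weak_deriv_def)
  then have "(-1) ^ k * ip f (trig_sum k N c d) = ((-1) ^ k * (-1) ^ k) * ip g (trig_sum 0 N c d)"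
    by (simp add: funpow_deriv_trig_sum)
  then show ?thesis by (simp flip: power_mult_distrib)
qed

definition fourier_cos :: "(real \<Rightarrow> real) \<Rightarrow> nat \<Rightarrow> real" where
  "fourier_cos f k = ip f (\<lambda>x. cos (real k * x)) / pi"

definition fourier_sin :: "(real \<Rightarrow> real) \<Rightarrow> nat \<Rightarrow> real" where
  "fourier_sin f k = ip f (\<lambda>x. sin (real k * x)) / pi"

lemma ip_trig_sum_fourier:
  assumes "f \<in> L2_per"
  shows "ip f (trig_sum 0 N c d) = pi * (\<Sum>k=1..N. fourier_cos f k * c k + fourier_sin f k * d k)"
  unfolding ip_trig_sum_right[OF assms] sum_distrib_left
  by (intro sum.cong) (simp_all add: fourier_cos_def fourier_sin_def field_simps)

lemma Bessel_inequality:
  assumes "f \<in> L2_per"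
  shows "pi * (\<Sum>k=1..N. (fourier_cos f k)\<^sup>2 + (fourier_sin f k)\<^sup>2) \<le> (nrm f)\<^sup>2"
proof -
  define w where "w = trig_sum 0 N (fourier_cos f) (fourier_sin f)"
  have w: "w \<in> L2_per" unfolding w_def by (rule trig_sum_L2)
  have "ip f w = pi * (\<Sum>k=1..N. (fourier_cos f k)\<^sup>2 + (fourier_sin f k)\<^sup>2)"
    unfolding w_def ip_trig_sum_fourier[OF assms] by (simp add: power2_eq_square)
  moreover have "ip w w = pi * (\<Sum>k=1..N. (fourier_cos f k)\<^sup>2 + (fourier_sin f k)\<^sup>2)"
    unfolding w_def ip_trig_sum_trig_sum by (simp add: power2_eq_square)
  moreover have "0 \<le> ip (\<lambda>x. f x - w x) (\<lambda>x. f x - w x)" by (rule ip_self_nonneg)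
  moreover have "ip (\<lambda>x. f x - w x) (\<lambda>x. f x - w x) = ip f f - 2 * ip f w + ip w w"
    using assms w by (simp add: ip_diff_left ip_diff_right L2_diff ip_sym[of w f])
  ultimately show ?thesis by (simp add: nrm_square)
qed

text \<open>Single modes are test functions whose fourth derivative is \<open>k^4\<close> times the mode itself.\<close>

lemma fourier_weak_deriv_4:
  assumes f: "f \<in> L2_per" and g: "has_weak_deriv 4 f g" and k: "1 \<le> k"
  shows "fourier_cos g k = real k ^ 4 * fourier_cos f k" "fourier_sin g k = real k ^ 4 * fourier_sin f k"
proof -
  have gL: "g \<in> L2_per" using g by (simp add: has_weak_deriv_def)
  define \<delta> :: "nat \<Rightarrow> real" where "\<delta> i = (if i = k then 1 else 0)" for i
  have shift: "cos (y + real 4 * (pi/2)) = cos y" "sin (y + real 4 * (pi/2)) = sin y" for y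
    by simp_all
  have one: "(\<Sum>i=1..k. h i * \<delta> i) = h k" for h :: "nat \<Rightarrow> real"
    unfolding \<delta>_def using k by (simp add: if_distrib cong: if_cong)
  have "pi * fourier_cos g k = ip g (trig_sum 0 k \<delta> (\<lambda>_. 0))"
    unfolding ip_trig_sum_fourier[OF gL] using one by simp
  also have "\<dots> = ip f (trig_sum 4 k \<delta> (\<lambda>_. 0))"
    using ip_weak_deriv_trig_sum[OF g] by simp
  also have "\<dots> = (\<Sum>i=1..k. (real i ^ 4 * ip f (\<lambda>x. cos (real i * x))) * \<delta> i)"
    unfolding ip_trig_sum_right[OF f] shift by (intro sum.cong) simp_all
  also have "\<dots> = real k ^ 4 * ip f (\<lambda>x. cos (real k * x))" by (rule one)
  finally show "fourier_cos g k = real k ^ 4 * fourier_cos f k"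
    by (simp add: fourier_cos_def field_simps)
  have "pi * fourier_sin g k = ip g (trig_sum 0 k (\<lambda>_. 0) \<delta>)"
    unfolding ip_trig_sum_fourier[OF gL] using one by simp
  also have "\<dots> = ip f (trig_sum 4 k (\<lambda>_. 0) \<delta>)"
    using ip_weak_deriv_trig_sum[OF g] by simp
  also have "\<dots> = (\<Sum>i=1..k. (real i ^ 4 * ip f (\<lambda>x. sin (real i * x))) * \<delta> i)"
    unfolding ip_trig_sum_right[OF f] shift by (intro sum.cong) simp_all
  also have "\<dots> = real k ^ 4 * ip f (\<lambda>x. sin (real k * x))" by (rule one)
  finally show "fourier_sin g k = real k ^ 4 * fourier_sin f k"
    by (simp add: fourier_sin_def field_simps)
qed

lemma cont_per_uniform_limit:
  fixes F :: "nat \<Rightarrow> real \<Rightarrow> real"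
  assumes lim: "uniform_limit UNIV F l sequentially" and F: "\<And>N. cont_per (F N)"
  shows "cont_per l"
proof
  show "continuous_on UNIV l"
    using uniform_limit_theorem[OF _ lim] F by auto
  have l: "(\<lambda>N. F N x) \<longlonglongrightarrow> l x" for x
    using tendsto_uniform_limitI[OF lim] by simp
  have "F N (x + 2*pi) = F N x" for N x
    using F by (simp add: periodic_def)
  then have "l (x + 2*pi) = l x" for x
    using LIMSEQ_unique[OF l[of "x + 2*pi"]] l[of x] by simp
  then show "periodic l" by (simp add: periodic_def)
qed

lemma nrm_uniform_limit:
  fixes F :: "nat \<Rightarrow> real \<Rightarrow> real"
  assumes lim: "uniform_limit UNIV F l sequentially" and F: "\<And>N. cont_per (F N)"
  shows "(\<lambda>N. nrm (\<lambda>x. l x - F N x)) \<longlonglongrightarrow> 0"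
proof -
  have l: "cont_per l" using lim F by (rule cont_per_uniform_limit)
  have one: "cont_per (\<lambda>x. 1)" by (simp add: periodic_def)
  \<comment> \<open>One is added only to make \<open>K\<close> positive.\<close>
  define K where "K = nrm (\<lambda>x. 1) + 1"
  have K: "K > 0" using nrm_nonneg[of "\<lambda>x. 1"] by (simp add: K_def)
  show ?thesis
  proof (rule LIMSEQ_I)
    fix e :: real assume "e > 0"
    then have "e / K > 0" using K by simp
    then have "eventually (\<lambda>N. \<forall>x\<in>UNIV. dist (F N x) (l x) < e / K) sequentially"
      by (rule uniform_limitD[OF lim])
    then obtain M where M: "\<And>N x. N \<ge> M \<Longrightarrow> \<bar>F N x - l x\<bar> < e / K"
      by (auto simp: eventually_sequentially dist_real_def)
    show "\<exists>M. \<forall>N\<ge>M. norm (nrm (\<lambda>x. l x - F N x) - 0) < e"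
    proof (intro exI allI impI)
      fix N assume "N \<ge> M"
      have "sup_nrm (\<lambda>x. l x - F N x) \<le> e / K"
        unfolding sup_nrm_def
        by (rule cSUP_least) (use M[OF \<open>N \<ge> M\<close>] in \<open>auto simp: abs_minus_commute less_imp_le\<close>)
      have "nrm (\<lambda>x. l x - F N x) \<le> sup_nrm (\<lambda>x. l x - F N x) * nrm (\<lambda>x. 1)"
        using nrm_mult_le[OF cont_per_diff[OF l F] one] by simp
      also have "\<dots> \<le> e / K * nrm (\<lambda>x. 1)"
        using \<open>sup_nrm _ \<le> _\<close> nrm_nonneg by (rule mult_right_mono)
      also have "\<dots> < e / K * K"
        using \<open>e / K > 0\<close> by (intro mult_strict_left_mono) (simp_all add: K_def)
      also have "\<dots> = e" using K by simp
      finally show "norm (nrm (\<lambda>x. l x - F N x) - 0) < e" using nrm_nonneg by simp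
    qed
  qed
qed

lemma ip_tendsto:
  assumes "(\<lambda>N. nrm (\<lambda>x. u x - v N x)) \<longlonglongrightarrow> 0" "u \<in> L2_per" "\<And>N. v N \<in> L2_per" "f \<in> L2_per"
  shows "(\<lambda>N. ip (v N) f) \<longlonglongrightarrow> ip u f"
proof (rule Lim_transform2)
  show "(\<lambda>N. ip u f) \<longlonglongrightarrow> ip u f" by simp
  show "(\<lambda>N. ip u f - ip (v N) f) \<longlonglongrightarrow> 0"
  proof (rule Lim_null_comparison)
    show "\<forall>\<^sub>F N in sequentially. norm (ip u f - ip (v N) f) \<le> nrm (\<lambda>x. u x - v N x) * nrm f"
      using Cauchy_Schwarz_ip[OF L2_diff[OF assms(2,3)] assms(4)] assms
      by (simp add: ip_diff_left)
    show "(\<lambda>N. nrm (\<lambda>x. u x - v N x) * nrm f) \<longlonglongrightarrow> 0"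
      using tendsto_mult_left_zero[OF assms(1)] by simp
  qed
qed

lemma nrm_tendsto:
  assumes "(\<lambda>N. nrm (\<lambda>x. u x - v N x)) \<longlonglongrightarrow> 0" "u \<in> L2_per" "\<And>N. v N \<in> L2_per"
  shows "(\<lambda>N. nrm (v N)) \<longlonglongrightarrow> nrm u"
proof (rule Lim_transform2)
  show "(\<lambda>N. nrm u) \<longlonglongrightarrow> nrm u" by simp
  show "(\<lambda>N. nrm u - nrm (v N)) \<longlonglongrightarrow> 0"
  proof (rule Lim_null_comparison)
    show "\<forall>\<^sub>F N in sequentially. norm (nrm u - nrm (v N)) \<le> nrm (\<lambda>x. u x - v N x)"
    proof (rule always_eventually, rule allI)
      fix N
      have "nrm u \<le> nrm (\<lambda>x. u x - v N x) + nrm (v N)"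
        using nrm_triangle[OF L2_diff[OF assms(2,3)] assms(3), of N N] by simp
      moreover have "nrm (v N) \<le> nrm (\<lambda>x. - 1 * (u x - v N x)) + nrm u"
        using nrm_triangle[OF L2_scale[OF L2_diff[OF assms(2,3)]] assms(2), of "-1" N] by simp
      moreover have "nrm (\<lambda>x. - 1 * (u x - v N x)) = nrm (\<lambda>x. u x - v N x)"
        unfolding nrm_eq ip_scale_left ip_scale_right by simp
      ultimately show "norm (nrm u - nrm (v N)) \<le> nrm (\<lambda>x. u x - v N x)" by auto
    qed
  qed (rule assms(1))
qed

lemma ip_trig_sum_const: "ip (trig_sum 0 N a b) (\<lambda>x. cos (real 0 * x)) = 0"
proof -
  have L: "(\<lambda>x. cos (real 0 * x)) \<in> L2_per" using cont_per_L2[OF cont_per_cos_phase[of 0 0]] by simp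
  have "fourier_cos (\<lambda>x. cos (real 0 * x)) k = 0" "fourier_sin (\<lambda>x. cos (real 0 * x)) k = 0" if "1 \<le> k" for k
    using ip_cos_cos[OF that, of 0 0 0] ip_cos_cos[OF that, of 0 0 "-pi/2"] that
    by (simp_all add: fourier_cos_def fourier_sin_def sin_as_cos)
  then show ?thesis
    unfolding ip_sym[of "trig_sum 0 N a b"] ip_trig_sum_fourier[OF L] by simp
qed

text \<open>Bessel's inequality for the weak derivative makes \<open>k^8 (a\<^sub>k\<^sup>2 + b\<^sub>k\<^sup>2)\<close> summable, and
  \<open>2 k\<^sup>3 \<bar>a\<^sub>k\<bar> \<le> k^8 a\<^sub>k\<^sup>2 + 1/k\<^sup>2\<close>.\<close>

lemma summable_weighted_fourier:
  assumes f: "f \<in> L2_per" and g: "has_weak_deriv 4 f g"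
  shows "summable (\<lambda>k. real k ^ 3 * (\<bar>fourier_cos f k\<bar> + \<bar>fourier_sin f k\<bar>))"
proof -
  have gL: "g \<in> L2_per" using g by (simp add: has_weak_deriv_def)
  define s where "s k = real k ^ 8 * ((fourier_cos f k)\<^sup>2 + (fourier_sin f k)\<^sup>2)" for k
  have s_eq: "s k = (fourier_cos g k)\<^sup>2 + (fourier_sin g k)\<^sup>2" if "1 \<le> k" for k
    using fourier_weak_deriv_4[OF f g that] by (simp add: s_def power_mult_distrib algebra_simps flip: power_mult)
  have "summable s"
  proof (rule summableI_nonneg_bounded)
    show "0 \<le> s k" for k by (simp add: s_def)
    fix N
    have "(\<Sum>k<N. s k) \<le> (\<Sum>k\<in>insert 0 {1..N}. s k)"
      by (intro sum_mono2) (auto simp: s_def)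
    also have "\<dots> = (\<Sum>k=1..N. (fourier_cos g k)\<^sup>2 + (fourier_sin g k)\<^sup>2)"
      using s_eq by (simp add: s_def)
    also have "\<dots> \<le> (nrm g)\<^sup>2 / pi"
      using Bessel_inequality[OF gL, of N] by (simp add: field_simps)
    finally show "(\<Sum>k<N. s k) \<le> (nrm g)\<^sup>2 / pi" .
  qed
  then have "summable (\<lambda>k. s k + inverse (real k ^ 2))"
    by (intro summable_add inverse_power_summable) auto
  then show ?thesis
  proof (rule summable_comparison_test'[where N = 0])
    fix k :: nat
    have *: "real k ^ 3 * \<bar>c\<bar> \<le> (real k ^ 8 * c\<^sup>2 + inverse (real k ^ 2)) / 2" for c
    proof (cases "k = 0")
      case False
      have "2 * ((real k ^ 4 * \<bar>c\<bar>) * inverse (real k)) \<le> (real k ^ 4 * \<bar>c\<bar>)\<^sup>2 + (inverse (real k))\<^sup>2"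
        using sum_squares_bound[of "real k ^ 4 * \<bar>c\<bar>" "inverse (real k)"] by (simp only: mult.assoc)
      moreover have "(real k ^ 4 * \<bar>c\<bar>) * inverse (real k) = real k ^ 3 * \<bar>c\<bar>"
        using False by (simp add: power_eq_if field_simps)
      moreover have "(real k ^ 4 * \<bar>c\<bar>)\<^sup>2 = real k ^ 8 * c\<^sup>2"
        by (simp add: power_mult_distrib flip: power_mult)
      moreover have "p' \<le> (q' + r) / 2" if "2 * p \<le> q + r" "p = p'" "q = q'" for p p' q q' r :: real
        using that by simp
      ultimately show ?thesis unfolding power_inverse by blast
    qed simp
    have "norm (real k ^ 3 * (\<bar>fourier_cos f k\<bar> + \<bar>fourier_sin f k\<bar>)) \<le> s k / 2 + inverse (real k ^ 2)"
    proof -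
      have "norm (real k ^ 3 * (\<bar>fourier_cos f k\<bar> + \<bar>fourier_sin f k\<bar>)) =
          real k ^ 3 * \<bar>fourier_cos f k\<bar> + real k ^ 3 * \<bar>fourier_sin f k\<bar>"
        by (simp add: distrib_left)
      moreover have "x + y \<le> (p + q) / 2 + r" if "x \<le> (p + r) / 2" "y \<le> (q + r) / 2" for x y p q r :: real
        using add_mono[OF that] by (simp add: field_simps)
      ultimately show ?thesis
        using *[of "fourier_cos f k"] *[of "fourier_sin f k"] unfolding s_def distrib_left by metis
    qed
    moreover have "0 \<le> s k" by (simp add: s_def)
    ultimately show "norm (real k ^ 3 * (\<bar>fourier_cos f k\<bar> + \<bar>fourier_sin f k\<bar>)) \<le> s k + inverse (real k ^ 2)"
      by linarith
  qed
qed

lemma trig_sum_uniform_limit: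
  assumes "summable (\<lambda>k. real k ^ 3 * (\<bar>a k\<bar> + \<bar>b k\<bar>))" "j \<le> 3"
  shows "\<exists>l. uniform_limit UNIV (\<lambda>N. trig_sum j N a b) l sequentially"
proof -
  define f where "f i x = real (Suc i) ^ j * (a (Suc i) * cos (real (Suc i) * x + real j * (pi/2))
      + b (Suc i) * sin (real (Suc i) * x + real j * (pi/2)))" for i x
  have "trig_sum j N a b x = (\<Sum>i<N. f i x)" for N x
    by (simp add: trig_sum_def f_def sum.atLeast1_atMost_eq)
  then have e: "(\<lambda>N. trig_sum j N a b) = (\<lambda>N x. \<Sum>i<N. f i x)" by (simp add: fun_eq_iff)
  have "uniform_limit UNIV (\<lambda>N x. \<Sum>i<N. f i x) (\<lambda>x. suminf (\<lambda>i. f i x)) sequentially"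
  proof (rule Weierstrass_m_test)
    show "summable (\<lambda>i. real (Suc i) ^ 3 * (\<bar>a (Suc i)\<bar> + \<bar>b (Suc i)\<bar>))"
      using assms(1) by (subst summable_Suc_iff)
    fix i x
    define c s where "c = cos (real (Suc i) * x + real j * (pi/2))" and "s = sin (real (Suc i) * x + real j * (pi/2))"
    have "\<bar>a (Suc i) * c + b (Suc i) * s\<bar> \<le> \<bar>a (Suc i)\<bar> * \<bar>c\<bar> + \<bar>b (Suc i)\<bar> * \<bar>s\<bar>"
      using abs_triangle_ineq[of "a (Suc i) * c" "b (Suc i) * s"] by (simp only: abs_mult)
    also have "\<dots> \<le> \<bar>a (Suc i)\<bar> * 1 + \<bar>b (Suc i)\<bar> * 1"
      by (intro add_mono mult_left_mono) (simp_all add: c_def s_def)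
    finally have "\<bar>a (Suc i) * c + b (Suc i) * s\<bar> \<le> \<bar>a (Suc i)\<bar> + \<bar>b (Suc i)\<bar>" by simp
    then have "real (Suc i) ^ j * \<bar>a (Suc i) * c + b (Suc i) * s\<bar> \<le> real (Suc i) ^ 3 * (\<bar>a (Suc i)\<bar> + \<bar>b (Suc i)\<bar>)"
      using assms(2) by (intro mult_mono power_increasing) auto
    then show "norm (f i x) \<le> real (Suc i) ^ 3 * (\<bar>a (Suc i)\<bar> + \<bar>b (Suc i)\<bar>)"
      by (simp add: f_def c_def s_def abs_mult)
  qed
  then show ?thesis unfolding e by blast
qed

text \<open>The mean-zero function \<open>u\<close> and the sum \<open>U\<close> of its Fourier series have the same Fourier
  coefficients, so completeness applies to their difference.\<close>

lemma ip_eq_ip_uniform_limit: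
  assumes u: "u \<in> H_space" and lim: "uniform_limit UNIV (\<lambda>N. trig_sum 0 N (fourier_cos u) (fourier_sin u)) U sequentially"
    and f: "f \<in> L2_per"
  shows "ip u f = ip U f"
proof -
  let ?v = "\<lambda>N. trig_sum 0 N (fourier_cos u) (fourier_sin u)"
  have uL: "u \<in> L2_per" using u by (simp add: H_space_def)
  have UL: "U \<in> L2_per" using cont_per_uniform_limit[OF lim] trig_sum_cont_per cont_per_L2 by blast
  note conv = ip_tendsto[OF nrm_uniform_limit[OF lim trig_sum_cont_per] UL trig_sum_L2]
  have Lc: "(\<lambda>x. cos (real k * x)) \<in> L2_per" and Ls: "(\<lambda>x. sin (real k * x)) \<in> L2_per" for k
    using cont_per_L2[OF cont_per_cos_phase[of k 0]] cont_per_L2[OF cont_per_sin_phase[of k 0]] by simp_all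
  have "ip (\<lambda>x. u x - U x) (\<lambda>x. cos (real k * x)) = 0" for k
  proof (cases "k = 0")
    case True
    have "ip U (\<lambda>x. cos (real 0 * x)) = 0"
      using conv[OF Lc[of 0]] by (simp only: ip_trig_sum_const LIMSEQ_const_iff)
    moreover have "ip u (\<lambda>x. cos (real 0 * x)) = 0"
      using u by (simp add: H_space_def ip_def)
    ultimately show ?thesis using True uL UL Lc[of 0] by (simp add: ip_diff_left)
  next
    case False
    have "ip (?v N) (\<lambda>x. cos (real k * x)) = ip u (\<lambda>x. cos (real k * x))" if "N \<ge> k" for N
      using ip_trig_sum_cos[of k N 0] that False by (simp add: fourier_cos_def)
    then have "(\<lambda>N. ip (?v N) (\<lambda>x. cos (real k * x))) \<longlonglongrightarrow> ip u (\<lambda>x. cos (real k * x))"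
      by (intro tendsto_eventually) (auto simp: eventually_sequentially)
    then show ?thesis
      using LIMSEQ_unique[OF conv[OF Lc[of k]]] uL UL Lc[of k] by (simp add: ip_diff_left)
  qed
  moreover have "ip (\<lambda>x. u x - U x) (\<lambda>x. sin (real k * x)) = 0" for k
  proof (cases "k = 0")
    case True
    then show ?thesis by (simp add: ip_def)
  next
    case False
    have "ip (?v N) (\<lambda>x. sin (real k * x)) = ip u (\<lambda>x. sin (real k * x))" if "N \<ge> k" for N
      using ip_trig_sum_sin[of k N 0] that False by (simp add: fourier_sin_def)
    then have "(\<lambda>N. ip (?v N) (\<lambda>x. sin (real k * x))) \<longlonglongrightarrow> ip u (\<lambda>x. sin (real k * x))"
      by (intro tendsto_eventually) (auto simp: eventually_sequentially)
    then show ?thesis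
      using LIMSEQ_unique[OF conv[OF Ls[of k]]] uL UL Ls[of k] by (simp add: ip_diff_left)
  qed
  ultimately have "ip (\<lambda>x. u x - U x) f = 0"
    using trig_orth_imp_ip_zero[OF L2_diff[OF uL UL]] by blast
  then show ?thesis using uL UL f by (simp add: ip_diff_left)
qed

lemma fourier_nrm_limit:
  assumes u: "u \<in> H_space" and lim: "uniform_limit UNIV (\<lambda>N. trig_sum 0 N (fourier_cos u) (fourier_sin u)) U sequentially"
  shows "(\<lambda>N. nrm (\<lambda>x. u x - trig_sum 0 N (fourier_cos u) (fourier_sin u) x)) \<longlonglongrightarrow> 0"
proof -
  let ?v = "\<lambda>N. trig_sum 0 N (fourier_cos u) (fourier_sin u)"
  have uL: "u \<in> L2_per" using u by (simp add: H_space_def)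
  have UL: "U \<in> L2_per" using cont_per_uniform_limit[OF lim] trig_sum_cont_per cont_per_L2 by blast
  have "ip (\<lambda>x. u x - ?v N x) (\<lambda>x. u x - ?v N x) = ip (\<lambda>x. U x - ?v N x) (\<lambda>x. U x - ?v N x)" for N
  proof -
    have eq: "ip (\<lambda>x. u x - ?v N x) f = ip (\<lambda>x. U x - ?v N x) f" if "f \<in> L2_per" for f
      using ip_eq_ip_uniform_limit[OF u lim that] that uL UL by (simp add: ip_diff_left trig_sum_L2)
    show ?thesis
      using eq[OF L2_diff[OF uL trig_sum_L2]] eq[OF L2_diff[OF UL trig_sum_L2]]
        ip_sym[of "\<lambda>x. U x - ?v N x" "\<lambda>x. u x - ?v N x"] by simp
  qed
  then show ?thesis using nrm_uniform_limit[OF lim trig_sum_cont_per] by (simp add: nrm_eq)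
qed

lemma ip_mult_move: "ip (\<lambda>x. c x * f x) g = ip f (\<lambda>x. c x * g x)"
  by (simp add: ip_def mult_ac)

section \<open>The quadratic form as a limit over Fourier partial sums\<close>

text \<open>The product is not differentiated itself: with \<open>D j\<close> the uniform limit of the \<open>j\<close>-th derivatives
  of the Fourier partial sums, the derivative \<open>W\<close> is given by the Leibniz formula with \<open>D j\<close> in place of
  the derivatives of \<open>u\<close>, and the defining identity is inherited from the partial sums.\<close>

lemma has_weak_deriv_3_mult:
  assumes u: "u \<in> H_space" and g: "has_weak_deriv 4 u g"
  shows "\<exists>W. has_weak_deriv 3 (\<lambda>x. trig_sum 1 n a b x * u x) W"
proof -
  let ?A = "fourier_cos u" and ?B = "fourier_sin u"
  have uL: "u \<in> L2_per" using u by (simp add: H_space_def)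
  have "\<forall>j. \<exists>l. j \<le> 3 \<longrightarrow> uniform_limit UNIV (\<lambda>N. trig_sum j N ?A ?B) l sequentially"
    using trig_sum_uniform_limit[OF summable_weighted_fourier[OF uL g]] by blast
  then obtain D where D: "\<And>j. j \<le> 3 \<Longrightarrow> uniform_limit UNIV (\<lambda>N. trig_sum j N ?A ?B) (D j) sequentially"
    by metis
  have cD: "cont_per (D j)" if "j \<le> 3" for j
    using cont_per_uniform_limit[OF D[OF that] trig_sum_cont_per] .
  have cD4: "cont_per (D 0)" "cont_per (D 1)" "cont_per (D 2)" "cont_per (D 3)"
    by (rule cD, simp)+
  define c where "c j = trig_sum (Suc j) n a b" for j
  have cc: "cont_per (c j)" for j unfolding c_def by (rule trig_sum_cont_per)
  have cder: "(c j has_real_derivative c (Suc j) x) (at x)" for j x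
    unfolding c_def by (rule trig_sum_deriv)
  define F where "F E j = (\<lambda>x. if j = 0 then c 0 x * E (0::nat) x
     else if j = 1 then c 1 x * E 0 x + c 0 x * E 1 x
     else if j = 2 then c 2 x * E 0 x + 2 * (c 1 x * E 1 x) + c 0 x * E 2 x
     else c 3 x * E 0 x + 3 * (c 2 x * E 1 x) + 3 * (c 1 x * E 2 x) + c 0 x * E 3 x)" for E and j :: nat
  define W where "W = F D 3"
  let ?t = "\<lambda>N j. trig_sum j N ?A ?B"
  have weak_N: "has_weak_deriv 3 (F (?t N) 0) (F (?t N) 3)" for N
  proof (rule has_weak_deriv_classical)
    show "cont_per (F (?t N) j)" for j
      unfolding F_def by (cases "j = 0"; cases "j = 1"; cases "j = 2")
        (auto simp: periodic_def intro!: continuous_intros cc[THEN conjunct2] trig_sum_cont_per[THEN conjunct2]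
           simp: cc[THEN conjunct1, unfolded periodic_def, rule_format] trig_sum_cont_per[THEN conjunct1, unfolded periodic_def, rule_format])
    fix j x assume "j < (3::nat)"
    then consider "j = 0" | "j = 1" | "j = 2" by linarith
    then show "(F (?t N) j has_real_derivative F (?t N) (Suc j) x) (at x)"
      by cases (auto simp: F_def eval_nat_numeral algebra_simps intro!: derivative_eq_intros cder trig_sum_deriv)
  qed
  have "has_weak_deriv 3 (\<lambda>x. trig_sum 1 n a b x * u x) W"
    unfolding has_weak_deriv_def
  proof (intro conjI allI impI)
    show "W \<in> L2_per"
      unfolding W_def F_def using cD cc by (auto intro!: cont_per_L2 cont_per_add cont_per_scale cont_per_mult)
    fix \<psi> assume psi: "smooth_per \<psi>"
    \<comment> \<open>Moving the coefficients to the test function leaves only limits of scalar products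
      with a fixed function.\<close>
    define p where "p = (deriv ^^ 3) \<psi>"
    have cp: "cont_per p" "cont_per \<psi>"
      using smooth_per_cont_per[OF psi, of 3] smooth_per_cont_per[OF psi, of 0] by (simp_all add: p_def)
    have split: "ip (F E 3) \<psi> = ip (E 0) (\<lambda>x. c 3 x * \<psi> x) + 3 * ip (E 1) (\<lambda>x. c 2 x * \<psi> x)
       + 3 * ip (E 2) (\<lambda>x. c 1 x * \<psi> x) + ip (E 3) (\<lambda>x. c 0 x * \<psi> x)" if "cont_per (E 0)" "cont_per (E 1)" "cont_per (E 2)" "cont_per (E 3)" for E
      unfolding F_def using that cc cp(2)
      by (simp add: ip_add_left ip_scale_left ip_mult_move cont_per_L2 cont_per_add cont_per_mult cont_per_scale)
    have lim: "(\<lambda>N. ip (?t N j) (\<lambda>x. c i x * \<psi> x)) \<longlonglongrightarrow> ip (D j) (\<lambda>x. c i x * \<psi> x)" if "j \<le> 3" for i j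
      using nrm_uniform_limit[OF D[OF that] trig_sum_cont_per] cont_per_L2 cD[OF that] trig_sum_L2 cont_per_mult[OF cc cp(2)]
      by (intro ip_tendsto) auto
    have l1: "(\<lambda>N. ip (F (?t N) 3) \<psi>) \<longlonglongrightarrow> ip W \<psi>"
      unfolding W_def split[of D, OF cD4] split[OF trig_sum_cont_per trig_sum_cont_per trig_sum_cont_per trig_sum_cont_per] by (intro tendsto_intros lim) auto
    have eq: "ip (F (?t N) 3) \<psi> = - ip (?t N 0) (\<lambda>x. c 0 x * p x)" for N
      using weak_N[of N] psi by (simp add: has_weak_deriv_def F_def p_def flip: ip_mult_move)
    have l2: "(\<lambda>N. - ip (?t N 0) (\<lambda>x. c 0 x * p x)) \<longlonglongrightarrow> - ip u (\<lambda>x. c 0 x * p x)"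
      using D[of 0] fourier_nrm_limit[OF u, of "D 0"] uL trig_sum_L2 cont_per_L2[OF cont_per_mult[OF cc cp(1)]]
      by (intro tendsto_minus ip_tendsto) auto
    have "ip W \<psi> = - ip u (\<lambda>x. c 0 x * p x)"
      using LIMSEQ_unique[OF l1[unfolded eq] l2] .
    then show "ip (\<lambda>x. trig_sum 1 n a b x * u x) ((deriv ^^ 3) \<psi>) = (- 1) ^ 3 * ip W \<psi>"
      by (simp add: ip_mult_move c_def p_def)
  qed
  then show ?thesis by blast
qed

text \<open>The quadratic form at the trigonometric sum \<open>v\<close> with coefficients \<open>c\<close> and \<open>d\<close>, namely
  \<open>-\<parallel>v\<^sub>x\<^sub>x\<parallel>\<^sup>2 + 2 \<langle>\<phi>\<^sub>x v, v\<^sub>x\<^sub>x\<^sub>x\<rangle>\<close>, with all derivatives explicit instead of weak; \<open>a\<close> and \<open>b\<close> are the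
  coefficients of \<open>\<phi>\<close>.\<close>

definition qform :: "nat \<Rightarrow> (nat \<Rightarrow> real) \<Rightarrow> (nat \<Rightarrow> real) \<Rightarrow> nat \<Rightarrow> (nat \<Rightarrow> real) \<Rightarrow> (nat \<Rightarrow> real) \<Rightarrow> real" where
  "qform n a b N c d = - ip (trig_sum 2 N c d) (trig_sum 2 N c d)
     + 2 * ip (\<lambda>x. trig_sum 1 n a b x * trig_sum 0 N c d x) (trig_sum 3 N c d)"

text \<open>The operator is defined through a choice of weak derivatives. This lemma shows that the choice
  succeeds, so that the form can be computed from the defining property of \<open>g\<close> and \<open>w\<close>.\<close>

lemma ip_A_op:
  assumes u: "u \<in> H_sob 4"
  obtains g w where "has_weak_deriv 4 u g" "has_weak_deriv 3 (\<lambda>x. trig_sum 1 n a b x * u x) w"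
    "ip (A_op (trig_sum 0 n a b) u) u = - ip g u - 2 * ip w u"
proof -
  have uH: "u \<in> H_space" and uL: "u \<in> L2_per" using u by (auto simp: H_sob_def H_space_def)
  have g: "has_weak_deriv 4 u (weak_deriv 4 u)"
  proof -
    have "\<exists>g. has_weak_deriv 4 u g" using u by (simp add: H_sob_def)
    then show ?thesis unfolding weak_deriv_def by (rule someI_ex)
  qed
  have w: "has_weak_deriv 3 (\<lambda>x. trig_sum 1 n a b x * u x) (weak_deriv 3 (\<lambda>x. trig_sum 1 n a b x * u x))"
    unfolding weak_deriv_def using has_weak_deriv_3_mult[OF uH g] by (rule someI_ex)
  define g' w' where "g' = weak_deriv 4 u" and "w' = weak_deriv 3 (\<lambda>x. trig_sum 1 n a b x * u x)"
  have L: "g' \<in> L2_per" "w' \<in> L2_per" using g w by (simp_all add: has_weak_deriv_def g'_def w'_def)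
  have "A_op (trig_sum 0 n a b) u = (\<lambda>x. (-1) * g' x - 2 * w' x)"
    by (simp add: A_op_def deriv_trig_sum g'_def w'_def)
  then have "ip (A_op (trig_sum 0 n a b) u) u = - ip g' u - 2 * ip w' u"
    using L uL by (simp only: ip_diff_left L2_scale ip_scale_left)
  then show ?thesis using that g w by (simp add: g'_def w'_def)
qed

text \<open>Let \<open>v\<close> be a partial sum. Testing \<open>g\<close> and \<open>w\<close> with \<open>v\<close> instead of \<open>u\<close> yields the form at \<open>v\<close> except
  that one factor \<open>u\<close> remains in \<open>\<langle>\<phi>\<^sub>x u, v\<^sub>x\<^sub>x\<^sub>x\<rangle>\<close>. Replacing it costs at most
  \<open>\<parallel>u - v\<parallel> \<parallel>\<phi>\<^sub>x\<parallel>\<^sub>\<infinity> \<parallel>v\<^sub>x\<^sub>x\<^sub>x\<parallel>\<close>, where the last factor is bounded by \<open>\<parallel>g\<parallel>\<close>.\<close>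

lemma qform_limit:
  assumes u: "u \<in> H_sob 4"
  shows "(\<lambda>N. qform n a b N (fourier_cos u) (fourier_sin u)) \<longlonglongrightarrow> ip (A_op (trig_sum 0 n a b) u) u"
    and "(\<lambda>N. nrm (trig_sum 0 N (fourier_cos u) (fourier_sin u))) \<longlonglongrightarrow> nrm u"
proof -
  obtain g w where g: "has_weak_deriv 4 u g" and w: "has_weak_deriv 3 (\<lambda>x. trig_sum 1 n a b x * u x) w"
    and A: "ip (A_op (trig_sum 0 n a b) u) u = - ip g u - 2 * ip w u"
    using ip_A_op[OF u] .
  have uH: "u \<in> H_space" and uL: "u \<in> L2_per" using u by (auto simp: H_sob_def H_space_def)
  have gL: "g \<in> L2_per" and wL: "w \<in> L2_per" using g w by (simp_all add: has_weak_deriv_def)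
  let ?t = "\<lambda>N j. trig_sum j N (fourier_cos u) (fourier_sin u)"
  define \<phi>1 where "\<phi>1 = trig_sum 1 n a b"
  have c\<phi>: "cont_per \<phi>1" unfolding \<phi>1_def by (rule trig_sum_cont_per)
  obtain U where U: "uniform_limit UNIV (\<lambda>N. ?t N 0) U sequentially"
    using trig_sum_uniform_limit[OF summable_weighted_fourier[OF uL g], of 0] by auto
  note lim = fourier_nrm_limit[OF uH U]
  show "(\<lambda>N. nrm (?t N 0)) \<longlonglongrightarrow> nrm u"
    using nrm_tendsto[OF lim uL trig_sum_L2] .
  have "(\<lambda>N. ip (?t N 0) g) \<longlonglongrightarrow> ip u g" "(\<lambda>N. ip (?t N 0) w) \<longlonglongrightarrow> ip u w"
    using ip_tendsto[OF lim uL trig_sum_L2] gL wL by blast+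
  then have main: "(\<lambda>N. - ip g (?t N 0) - 2 * ip w (?t N 0)) \<longlonglongrightarrow> - ip g u - 2 * ip w u"
    by (intro tendsto_intros) (simp_all add: ip_sym[of _ g] ip_sym[of _ w])
  have g_eq: "ip g (?t N 0) = ip (?t N 2) (?t N 2)" for N
    unfolding ip_trig_sum_fourier[OF gL] ip_trig_sum_trig_sum
    by (intro arg_cong[where f = "(*) pi"] sum.cong) (simp_all add: fourier_weak_deriv_4[OF uL g] algebra_simps)
  have w_eq: "ip w (?t N 0) = - ip (\<lambda>x. \<phi>1 x * u x) (?t N 3)" for N
    using ip_weak_deriv_trig_sum[OF w] by (simp add: \<phi>1_def)
  have t3: "nrm (?t N 3) \<le> nrm g" for N
  proof -
    have "(nrm (?t N 3))\<^sup>2 \<le> pi * (\<Sum>k=1..N. (fourier_cos g k)\<^sup>2 + (fourier_sin g k)\<^sup>2)"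
      unfolding nrm_trig_sum_sq
    proof (intro mult_left_mono sum_mono)
      fix k assume "k \<in> {1..N}"
      then have k: "1 \<le> k" by simp
      have "real k ^ (2*3) \<le> real k ^ 8" using k by (intro power_increasing) auto
      then have "real k ^ (2*3) * ((fourier_cos u k)\<^sup>2 + (fourier_sin u k)\<^sup>2) \<le> real k ^ 8 * ((fourier_cos u k)\<^sup>2 + (fourier_sin u k)\<^sup>2)"
        by (rule mult_right_mono) simp
      also have "\<dots> = (fourier_cos g k)\<^sup>2 + (fourier_sin g k)\<^sup>2"
        using fourier_weak_deriv_4[OF uL g k] by (simp add: power_mult_distrib algebra_simps flip: power_mult)
      finally show "real k ^ (2*3) * ((fourier_cos u k)\<^sup>2 + (fourier_sin u k)\<^sup>2) \<le> (fourier_cos g k)\<^sup>2 + (fourier_sin g k)\<^sup>2" .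
    qed simp
    also have "\<dots> \<le> (nrm g)\<^sup>2" by (rule Bessel_inequality[OF gL])
    finally show ?thesis using nrm_nonneg by (rule power2_le_imp_le)
  qed
  have diff: "(- ip g (?t N 0) - 2 * ip w (?t N 0)) - qform n a b N (fourier_cos u) (fourier_sin u)
     = 2 * ip (\<lambda>x. u x - ?t N 0 x) (\<lambda>x. \<phi>1 x * ?t N 3 x)" for N
    unfolding qform_def g_eq w_eq \<phi>1_def[symmetric] ip_mult_move
    using uL cont_per_L2[OF cont_per_mult[OF c\<phi> trig_sum_cont_per]] trig_sum_L2 by (simp add: ip_diff_left)
  have "(\<lambda>N. 2 * ip (\<lambda>x. u x - ?t N 0 x) (\<lambda>x. \<phi>1 x * ?t N 3 x)) \<longlonglongrightarrow> 0"
  proof (rule Lim_null_comparison)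
    show "\<forall>\<^sub>F N in sequentially. norm (2 * ip (\<lambda>x. u x - ?t N 0 x) (\<lambda>x. \<phi>1 x * ?t N 3 x))
       \<le> 2 * (nrm (\<lambda>x. u x - ?t N 0 x) * (sup_nrm \<phi>1 * nrm g))"
    proof (rule always_eventually, rule allI)
      fix N
      have "\<bar>ip (\<lambda>x. u x - ?t N 0 x) (\<lambda>x. \<phi>1 x * ?t N 3 x)\<bar> \<le> nrm (\<lambda>x. u x - ?t N 0 x) * nrm (\<lambda>x. \<phi>1 x * ?t N 3 x)"
        by (intro Cauchy_Schwarz_ip L2_diff uL trig_sum_L2 cont_per_L2 cont_per_mult c\<phi> trig_sum_cont_per)
      also have "\<dots> \<le> nrm (\<lambda>x. u x - ?t N 0 x) * (sup_nrm \<phi>1 * nrm (?t N 3))"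
        by (intro mult_left_mono nrm_mult_le c\<phi> trig_sum_cont_per nrm_nonneg)
      also have "\<dots> \<le> nrm (\<lambda>x. u x - ?t N 0 x) * (sup_nrm \<phi>1 * nrm g)"
        by (intro mult_left_mono t3 nrm_nonneg sup_nrm_nonneg c\<phi>)
      finally show "norm (2 * ip (\<lambda>x. u x - ?t N 0 x) (\<lambda>x. \<phi>1 x * ?t N 3 x))
         \<le> 2 * (nrm (\<lambda>x. u x - ?t N 0 x) * (sup_nrm \<phi>1 * nrm g))" by simp
    qed
    have "(\<lambda>N. 2 * (nrm (\<lambda>x. u x - ?t N 0 x) * (sup_nrm \<phi>1 * nrm g))) \<longlonglongrightarrow> 2 * (0 * (sup_nrm \<phi>1 * nrm g))"
      by (intro tendsto_intros lim)
    then show "(\<lambda>N. 2 * (nrm (\<lambda>x. u x - ?t N 0 x) * (sup_nrm \<phi>1 * nrm g))) \<longlonglongrightarrow> 0" by simp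
  qed
  then have "(\<lambda>N. (- ip g (?t N 0) - 2 * ip w (?t N 0)) - qform n a b N (fourier_cos u) (fourier_sin u)) \<longlonglongrightarrow> 0"
    by (simp only: diff)
  from tendsto_diff[OF main this] show "(\<lambda>N. qform n a b N (fourier_cos u) (fourier_sin u)) \<longlonglongrightarrow> ip (A_op (trig_sum 0 n a b) u) u"
    by (simp add: A)
qed

lemma trig_sum_H_sob: "trig_sum 0 N c d \<in> H_sob 4"
proof -
  have "ip (trig_sum 0 N c d) (\<lambda>x. cos (real 0 * x)) = 0" by (rule ip_trig_sum_const)
  then have "trig_sum 0 N c d \<in> H_space"
    using trig_sum_L2 by (simp add: H_space_def ip_def)
  moreover have "has_weak_deriv 4 (trig_sum 0 N c d) (trig_sum 4 N c d)"
    by (rule has_weak_deriv_classical[where F = "\<lambda>j. trig_sum j N c d"]) (rule trig_sum_deriv, rule trig_sum_cont_per)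
  ultimately show ?thesis by (auto simp: H_sob_def)
qed

lemma ip_trig_sum_parts: "ip (trig_sum (Suc i) N c d) (trig_sum j N c d) = - ip (trig_sum i N c d) (trig_sum (Suc j) N c d)"
  by (intro ip_by_parts trig_sum_deriv trig_sum_cont_per trig_sum_cont_per[THEN conjunct1])

lemma ip_A_op_trig_sum: "ip (A_op (trig_sum 0 n a b) (trig_sum 0 N c d)) (trig_sum 0 N c d) = qform n a b N c d"
proof -
  let ?u = "trig_sum 0 N c d"
  obtain g w where g: "has_weak_deriv 4 ?u g" and w: "has_weak_deriv 3 (\<lambda>x. trig_sum 1 n a b x * ?u x) w"
    and A: "ip (A_op (trig_sum 0 n a b) ?u) ?u = - ip g ?u - 2 * ip w ?u"
    using ip_A_op[OF trig_sum_H_sob] .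
  have "ip g ?u = ip ?u (trig_sum 4 N c d)"
    using ip_weak_deriv_trig_sum[OF g] by simp
  also have "\<dots> = ip (trig_sum 2 N c d) (trig_sum 2 N c d)"
    using ip_trig_sum_parts[of 0 N c d 3] ip_trig_sum_parts[of 1 N c d 2] by (simp add: eval_nat_numeral)
  finally show ?thesis
    using ip_weak_deriv_trig_sum[OF w] by (simp add: A qform_def)
qed

section \<open>Estimates of the form on trigonometric sums\<close>

lemma ip_parts_mult:
  "ip (\<lambda>x. trig_sum i n a b x * trig_sum k N c d x) (trig_sum (Suc j) N c' d') =
   - ip (\<lambda>x. trig_sum (Suc i) n a b x * trig_sum k N c d x) (trig_sum j N c' d')
   - ip (\<lambda>x. trig_sum i n a b x * trig_sum (Suc k) N c d x) (trig_sum j N c' d')"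
proof -
  let ?f = "\<lambda>x. trig_sum i n a b x * trig_sum k N c d x"
  let ?f' = "\<lambda>x. trig_sum (Suc i) n a b x * trig_sum k N c d x + trig_sum i n a b x * trig_sum (Suc k) N c d x"
  have "ip ?f' (trig_sum j N c' d') = - ip ?f (trig_sum (Suc j) N c' d')"
  proof (rule ip_by_parts)
    show "(?f has_real_derivative ?f' x) (at x)" for x
      using DERIV_mult[OF trig_sum_deriv[of i n a b x] trig_sum_deriv[of k N c d x]] by (simp add: mult.commute)
    show "cont_per ?f'" by (intro cont_per_add cont_per_mult trig_sum_cont_per)
    show "periodic ?f" using cont_per_mult[OF trig_sum_cont_per trig_sum_cont_per] by blast
  qed (intro trig_sum_deriv trig_sum_cont_per trig_sum_cont_per[THEN conjunct1])+
  moreover have "ip ?f' (trig_sum j N c' d') = ip (\<lambda>x. trig_sum (Suc i) n a b x * trig_sum k N c d x) (trig_sum j N c' d')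
     + ip (\<lambda>x. trig_sum i n a b x * trig_sum (Suc k) N c d x) (trig_sum j N c' d')"
    by (intro ip_add_left cont_per_L2 cont_per_mult trig_sum_cont_per)
  ultimately show ?thesis by simp
qed

lemma qform_cubic_eq:
  "2 * ip (\<lambda>x. trig_sum 1 n a b x * trig_sum 0 N c d x) (trig_sum 3 N c d) =
     ip (\<lambda>x. trig_sum 2 n a b x * trig_sum 1 N c d x) (trig_sum 1 N c d)
     - 2 * ip (\<lambda>x. trig_sum 2 n a b x * trig_sum 0 N c d x) (trig_sum 2 N c d)"
proof -
  have "ip (\<lambda>x. trig_sum 1 n a b x * trig_sum 2 N c d x) (trig_sum 1 N c d) = ip (\<lambda>x. trig_sum 1 n a b x * trig_sum 1 N c d x) (trig_sum 2 N c d)"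
    by (simp add: ip_def mult_ac)
  then show ?thesis
    using ip_parts_mult[of 1 n a b 0 N c d 2 c d] ip_parts_mult[of 1 n a b 1 N c d 1 c d]
    by (simp add: eval_nat_numeral)
qed

lemma nrm_interpolation: "(nrm (trig_sum 1 N c d))\<^sup>2 \<le> nrm (trig_sum 0 N c d) * nrm (trig_sum 2 N c d)"
proof -
  have "ip (trig_sum 1 N c d) (trig_sum 1 N c d) = - ip (trig_sum 0 N c d) (trig_sum 2 N c d)"
    using ip_trig_sum_parts[of 0 N c d 1] by (simp add: eval_nat_numeral)
  then show ?thesis
    using Cauchy_Schwarz_ip[OF trig_sum_L2[of 0 N c d] trig_sum_L2[of 2 N c d]] by (simp add: nrm_square)
qed

text \<open>The interpolation inequality \<open>\<parallel>v\<^sub>x\<parallel>\<^sup>2 \<le> \<parallel>v\<parallel> \<parallel>v\<^sub>x\<^sub>x\<parallel>\<close> makes both terms that contain \<open>\<phi>\<close> of the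
  same size; they contribute once and twice to the constant \<open>3\<close>.\<close>

lemma qform_deviation:
  "\<bar>qform n a b N c d + (nrm (trig_sum 2 N c d))\<^sup>2\<bar>
    \<le> 3 * sup_nrm (trig_sum 2 n a b) * nrm (trig_sum 0 N c d) * nrm (trig_sum 2 N c d)"
proof -
  let ?M = "sup_nrm (trig_sum 2 n a b)"
  have M: "0 \<le> ?M" by (intro sup_nrm_nonneg trig_sum_cont_per)
  have "\<bar>ip (\<lambda>x. trig_sum 2 n a b x * trig_sum 1 N c d x) (trig_sum 1 N c d)\<bar> \<le> ?M * nrm (trig_sum 1 N c d) * nrm (trig_sum 1 N c d)"
    by (intro ip_mult_bound trig_sum_cont_per)
  also have "\<dots> \<le> ?M * (nrm (trig_sum 0 N c d) * nrm (trig_sum 2 N c d))"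
    using mult_left_mono[OF nrm_interpolation M] by (simp add: power2_eq_square mult.assoc)
  finally have 1: "\<bar>ip (\<lambda>x. trig_sum 2 n a b x * trig_sum 1 N c d x) (trig_sum 1 N c d)\<bar> \<le> ?M * nrm (trig_sum 0 N c d) * nrm (trig_sum 2 N c d)"
    by (simp add: mult.assoc)
  have 2: "\<bar>ip (\<lambda>x. trig_sum 2 n a b x * trig_sum 0 N c d x) (trig_sum 2 N c d)\<bar> \<le> ?M * nrm (trig_sum 0 N c d) * nrm (trig_sum 2 N c d)"
    by (intro ip_mult_bound trig_sum_cont_per)
  have "qform n a b N c d + (nrm (trig_sum 2 N c d))\<^sup>2 = ip (\<lambda>x. trig_sum 2 n a b x * trig_sum 1 N c d x) (trig_sum 1 N c d)
     - 2 * ip (\<lambda>x. trig_sum 2 n a b x * trig_sum 0 N c d x) (trig_sum 2 N c d)"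
    unfolding qform_def qform_cubic_eq nrm_square by simp
  then show ?thesis using 1 2 by linarith
qed

lemma qform_upper:
  "qform n a b N c d \<le> - (nrm (trig_sum 2 N c d))\<^sup>2 / 2 + 9 / 2 * (sup_nrm (trig_sum 2 n a b))\<^sup>2 * (nrm (trig_sum 0 N c d))\<^sup>2"
proof -
  have "2 * (3 * sup_nrm (trig_sum 2 n a b) * nrm (trig_sum 0 N c d)) * nrm (trig_sum 2 N c d)
     \<le> (3 * sup_nrm (trig_sum 2 n a b) * nrm (trig_sum 0 N c d))\<^sup>2 + (nrm (trig_sum 2 N c d))\<^sup>2"
    by (rule sum_squares_bound)
  then show ?thesis
    using qform_deviation[of n a b N c d] by (simp add: power_mult_distrib abs_le_iff)
qed

lemma nrm_trig_sum_mono: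
  assumes "i \<le> j"
  shows "nrm (trig_sum i N c d) \<le> nrm (trig_sum j N c d)"
proof -
  have "(nrm (trig_sum i N c d))\<^sup>2 \<le> (nrm (trig_sum j N c d))\<^sup>2"
    unfolding nrm_trig_sum_sq using assms
    by (intro mult_left_mono sum_mono mult_right_mono power_increasing) auto
  then show ?thesis using nrm_nonneg by (rule power2_le_imp_le)
qed

lemma nrm_trig_sum_high:
  assumes "\<And>k. k \<le> n \<Longrightarrow> c k = 0 \<and> d k = 0"
  shows "real (n + 1) * nrm (trig_sum j N c d) \<le> nrm (trig_sum (Suc j) N c d)"
proof -
  have "(real (n + 1) * nrm (trig_sum j N c d))\<^sup>2 \<le> (nrm (trig_sum (Suc j) N c d))\<^sup>2"
    unfolding power_mult_distrib nrm_trig_sum_sq sum_distrib_left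
  proof (intro sum_mono)
    fix k
    show "(real (n + 1))\<^sup>2 * (pi * (real k ^ (2*j) * ((c k)\<^sup>2 + (d k)\<^sup>2))) \<le> pi * (real k ^ (2 * Suc j) * ((c k)\<^sup>2 + (d k)\<^sup>2))"
    proof (cases "k \<le> n")
      case False
      then have "(real (n + 1))\<^sup>2 \<le> (real k)\<^sup>2" by (intro power_mono) auto
      then have "(real (n + 1))\<^sup>2 * (pi * (real k ^ (2*j) * ((c k)\<^sup>2 + (d k)\<^sup>2)))
         \<le> (real k)\<^sup>2 * (pi * (real k ^ (2*j) * ((c k)\<^sup>2 + (d k)\<^sup>2)))"
        by (rule mult_right_mono) simp
      then show ?thesis by (simp add: power2_eq_square mult_ac)
    qed (use assms in simp)
  qed
  then show ?thesis using nrm_nonneg by (rule power2_le_imp_le)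
qed

lemma trig_sum_add: "trig_sum j N (\<lambda>k. c k + c' k) (\<lambda>k. d k + d' k) = (\<lambda>x. trig_sum j N c d x + trig_sum j N c' d' x)"
  by (simp add: trig_sum_def fun_eq_iff distrib_left distrib_right flip: sum.distrib) (simp add: algebra_simps)

lemma trig_sum_scale: "trig_sum j N (\<lambda>k. s * c k) (\<lambda>k. s * d k) = (\<lambda>x. s * trig_sum j N c d x)"
  by (simp add: trig_sum_def fun_eq_iff sum_distrib_left algebra_simps)

lemma qform_scale: "qform n a b N (\<lambda>k. s * c k) (\<lambda>k. s * d k) = s\<^sup>2 * qform n a b N c d"
proof -
  have "ip (\<lambda>x. f x * (s * g x)) h = s * ip (\<lambda>x. f x * g x) h" for f g h
    using ip_scale_left[of s "\<lambda>x. f x * g x" h] by (simp add: mult_ac)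
  then show ?thesis
    unfolding qform_def trig_sum_scale
    by (simp add: ip_scale_left ip_scale_right power2_eq_square algebra_simps)
qed

text \<open>Here \<open>p\<close> and \<open>q\<close> have coefficients \<open>c, d\<close> and \<open>c', d'\<close>. In \<open>\<langle>\<phi>\<^sub>x p, q\<^sub>x\<^sub>x\<^sub>x\<rangle>\<close> two derivatives are moved to
  the first factor, and in \<open>\<langle>\<phi>\<^sub>x q, p\<^sub>x\<^sub>x\<^sub>x\<rangle>\<close> one. No term then contains more than two derivatives of \<open>p\<close> or
  one of \<open>q\<close>, lower ones are dominated because there is no constant mode, and the coefficients add up
  to \<open>C_const\<close>.\<close>

lemma qform_cross:
  assumes "ip (trig_sum 2 N c d) (trig_sum 2 N c' d') = 0"
  shows "qform n a b N (\<lambda>k. c k + c' k) (\<lambda>k. d k + d' k) \<le> qform n a b N c d + qform n a b N c' d'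
     + C_const (trig_sum 0 n a b) * nrm (trig_sum 2 N c d) * nrm (trig_sum 1 N c' d')"
proof -
  let ?p = "\<lambda>j. trig_sum j N c d" and ?q = "\<lambda>j. trig_sum j N c' d'" and ?f = "\<lambda>j. trig_sum j n a b"
  let ?M = "\<lambda>j. sup_nrm (?f j)"
  let ?X = "nrm (?p 2)" and ?Y = "nrm (?q 1)"
  have X: "0 \<le> ?X" and Y: "0 \<le> ?Y" by (rule nrm_nonneg)+
  have M: "0 \<le> ?M j" for j by (intro sup_nrm_nonneg trig_sum_cont_per)
  have bound_p: "\<bar>ip (\<lambda>x. ?f i x * ?p j x) (?q 1)\<bar> \<le> ?M i * ?X * ?Y" if "j \<le> 2" for i j
  proof -
    have "\<bar>ip (\<lambda>x. ?f i x * ?p j x) (?q 1)\<bar> \<le> ?M i * nrm (?p j) * ?Y"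
      by (intro ip_mult_bound trig_sum_cont_per)
    also have "\<dots> \<le> ?M i * ?X * ?Y"
      using nrm_trig_sum_mono[OF that] M Y by (intro mult_right_mono mult_left_mono)
    finally show ?thesis .
  qed
  have bound_q: "\<bar>ip (\<lambda>x. ?f i x * ?q j x) (?p 2)\<bar> \<le> ?M i * ?X * ?Y" if "j \<le> 1" for i j
  proof -
    have "\<bar>ip (\<lambda>x. ?f i x * ?q j x) (?p 2)\<bar> \<le> ?M i * nrm (?q j) * ?X"
      by (intro ip_mult_bound trig_sum_cont_per)
    also have "\<dots> \<le> ?M i * ?Y * ?X"
      using nrm_trig_sum_mono[OF that] M X by (intro mult_right_mono mult_left_mono)
    finally show ?thesis by (simp add: mult_ac)
  qed
  have e1: "ip (\<lambda>x. ?f 1 x * ?p 0 x) (?q 3) = ip (\<lambda>x. ?f 3 x * ?p 0 x) (?q 1)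
     + 2 * ip (\<lambda>x. ?f 2 x * ?p 1 x) (?q 1) + ip (\<lambda>x. ?f 1 x * ?p 2 x) (?q 1)"
    using ip_parts_mult[of 1 n a b 0 N c d 2 c' d'] ip_parts_mult[of 2 n a b 0 N c d 1 c' d']
      ip_parts_mult[of 1 n a b 1 N c d 1 c' d'] by (simp add: eval_nat_numeral)
  have e2: "ip (\<lambda>x. ?f 1 x * ?q 0 x) (?p 3) = - ip (\<lambda>x. ?f 2 x * ?q 0 x) (?p 2) - ip (\<lambda>x. ?f 1 x * ?q 1 x) (?p 2)"
    using ip_parts_mult[of 1 n a b 0 N c' d' 2 c d] by (simp add: eval_nat_numeral)
  have C: "C_const (?f 0) * ?X * ?Y = 2 * (?M 3 * ?X * ?Y) + 6 * (?M 2 * ?X * ?Y) + 4 * (?M 1 * ?X * ?Y)"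
    unfolding C_const_def funpow_deriv_trig_sum deriv_trig_sum by (simp add: algebra_simps numeral_2_eq_2)
  have "2 * ip (\<lambda>x. ?f 1 x * ?p 0 x) (?q 3) + 2 * ip (\<lambda>x. ?f 1 x * ?q 0 x) (?p 3) \<le> C_const (?f 0) * ?X * ?Y"
  proof -
    have sum_bound: "2 * (A + 2 * B + D) + 2 * (- E - F) \<le> 2 * u + 6 * v + 4 * w"
      if "\<bar>A\<bar> \<le> u" "\<bar>B\<bar> \<le> v" "\<bar>D\<bar> \<le> w" "\<bar>E\<bar> \<le> v" "\<bar>F\<bar> \<le> w" for A B D E F u v w :: real
      using that unfolding abs_le_iff by (simp add: algebra_simps)
    show ?thesis
      unfolding e1 e2 C
      by (rule sum_bound) (rule bound_p bound_q, simp)+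
  qed
  moreover have "qform n a b N (\<lambda>k. c k + c' k) (\<lambda>k. d k + d' k) = qform n a b N c d + qform n a b N c' d'
     - 2 * ip (?p 2) (?q 2) + 2 * ip (\<lambda>x. ?f 1 x * ?p 0 x) (?q 3) + 2 * ip (\<lambda>x. ?f 1 x * ?q 0 x) (?p 3)"
    unfolding qform_def trig_sum_add distrib_left
    by (simp add: ip_add_left ip_add_right cont_per_L2 cont_per_mult cont_per_add trig_sum_cont_per ip_sym[of "?q 2" "?p 2"])
  ultimately show ?thesis using assms by linarith
qed

section \<open>The Galerkin bound\<close>

lemma trig_sum_truncate:
  assumes "n \<le> N"
  shows "trig_sum j N (\<lambda>k. if k \<le> n then c k else 0) (\<lambda>k. if k \<le> n then d k else 0) = trig_sum j n c d"
proof
  fix x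
  have "(\<Sum>k=1..N. real k ^ j * ((if k \<le> n then c k else 0) * cos (real k * x + real j * (pi/2)) +
      (if k \<le> n then d k else 0) * sin (real k * x + real j * (pi/2)))) =
    (\<Sum>k=1..n. real k ^ j * ((if k \<le> n then c k else 0) * cos (real k * x + real j * (pi/2)) +
      (if k \<le> n then d k else 0) * sin (real k * x + real j * (pi/2))))"
    using assms by (intro sum.mono_neutral_right) auto
  then show "trig_sum j N (\<lambda>k. if k \<le> n then c k else 0) (\<lambda>k. if k \<le> n then d k else 0) x = trig_sum j n c d x"
    by (simp add: trig_sum_def)
qed

lemma lam_fin_alt:
  "lam_fin n (trig_sum 0 n a b) = Sup {qform n a b n c d | c d. nrm (trig_sum 0 n c d) = 1}"
proof -
  have "{ip (A_op (trig_sum 0 n a b) u) u | u. u \<in> H_fin n \<and> nrm u = 1} = {qform n a b n c d | c d. nrm (trig_sum 0 n c d) = 1}"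
    unfolding H_fin_iff using ip_A_op_trig_sum[of n a b n] by (intro Collect_cong) metis
  then show ?thesis by (simp add: lam_fin_def)
qed

lemma bdd_above_qform: "bdd_above {qform n a b N c d | c d. nrm (trig_sum 0 N c d) = 1}"
proof (rule bdd_aboveI[of _ "9 / 2 * (sup_nrm (trig_sum 2 n a b))\<^sup>2"], clarify)
  fix c d assume "nrm (trig_sum 0 N c d) = 1"
  then have "qform n a b N c d \<le> - (nrm (trig_sum 2 N c d))\<^sup>2 / 2 + 9 / 2 * (sup_nrm (trig_sum 2 n a b))\<^sup>2"
    using qform_upper[of n a b N c d] by simp
  also have "\<dots> \<le> 9 / 2 * (sup_nrm (trig_sum 2 n a b))\<^sup>2" by simp
  finally show "qform n a b N c d \<le> 9 / 2 * (sup_nrm (trig_sum 2 n a b))\<^sup>2" .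
qed

text \<open>Homogeneity removes the normalisation. If \<open>\<parallel>v\<parallel> = 0\<close>, scaling is impossible, but the upper bound
  for the form is then nonpositive.\<close>

lemma qform_le_lam_fin:
  "qform n a b n c d \<le> lam_fin n (trig_sum 0 n a b) * (nrm (trig_sum 0 n c d))\<^sup>2"
proof (cases "nrm (trig_sum 0 n c d) = 0")
  case True
  then have "qform n a b n c d \<le> - (nrm (trig_sum 2 n c d))\<^sup>2 / 2"
    using qform_upper[of n a b n c d] by simp
  also have "\<dots> \<le> 0" by simp
  finally show ?thesis using True by simp
next
  case False
  define s where "s = 1 / nrm (trig_sum 0 n c d)"
  have "nrm (trig_sum 0 n (\<lambda>k. s * c k) (\<lambda>k. s * d k)) = 1"
    unfolding trig_sum_scale nrm_eq[of "\<lambda>x. s * _ x"] ip_scale_left ip_scale_right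
      nrm_square[symmetric]
    using False by (simp add: s_def power2_eq_square)
  then have "qform n a b n (\<lambda>k. s * c k) (\<lambda>k. s * d k) \<le> lam_fin n (trig_sum 0 n a b)"
    unfolding lam_fin_alt by (intro cSup_upper bdd_above_qform) blast
  then have "s\<^sup>2 * qform n a b n c d \<le> lam_fin n (trig_sum 0 n a b)"
    by (simp only: qform_scale)
  then show ?thesis using False by (simp add: s_def field_simps power_divide)
qed

lemma nrm_unit_cos:
  assumes "1 \<le> N"
  defines "c \<equiv> (\<lambda>k. if k = (1::nat) then 1 / sqrt pi else 0)"
  shows "nrm (trig_sum j N c (\<lambda>_. 0)) = 1"
proof -
  have "(\<Sum>k=1..N. real k ^ (2*j) * ((c k)\<^sup>2 + (0::real)\<^sup>2)) = (\<Sum>k=1..N. if k = 1 then 1 / pi else 0)"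
    by (intro sum.cong) (auto simp: c_def power_divide)
  also have "\<dots> = 1 / pi" using assms(1) by simp
  finally have "(nrm (trig_sum j N c (\<lambda>_. 0)))\<^sup>2 = 1"
    unfolding nrm_trig_sum_sq by simp
  then show ?thesis using nrm_nonneg[of "trig_sum j N c (\<lambda>_. 0)"] by (simp add: power2_eq_1_iff)
qed

lemma lam_fin_lower:
  assumes "1 \<le> n"
  shows "- 1 - 3 * sup_nrm (trig_sum 2 n a b) \<le> lam_fin n (trig_sum 0 n a b)"
proof -
  let ?c = "\<lambda>k. if k = (1::nat) then 1 / sqrt pi else 0"
  have "- 1 - 3 * sup_nrm (trig_sum 2 n a b) \<le> qform n a b n ?c (\<lambda>_. 0)"
    using qform_deviation[of n a b n ?c "\<lambda>_. 0", unfolded nrm_unit_cos[OF assms]] by (simp add: abs_le_iff)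
  also have "\<dots> \<le> lam_fin n (trig_sum 0 n a b)"
    using qform_le_lam_fin[of n a b ?c "\<lambda>_. 0", unfolded nrm_unit_cos[OF assms]] by simp
  finally show ?thesis .
qed

text \<open>In the case \<open>L < 0\<close> the condition on \<open>n\<close> yields \<open>72 M\<^sup>2 \<le> n\<^sup>2\<close> and \<open>6 M \<le> n\<close>, and
  \<open>(n + 1)\<^sup>4/4 \<ge> n\<^sup>2 + 2 n + 1\<close> outweighs \<open>9/2 M\<^sup>2 + 3 M + 1\<close>. With \<open>n\<^sup>4\<close> in place of
  \<open>(n + 1)\<^sup>4\<close> this would fail for \<open>n = 1\<close>.\<close>

lemma tail_coefficient_bound:
  fixes C L M :: real
  assumes n: "1 \<le> n" and M: "0 \<le> M" and C: "6 * M \<le> C" "2 * C\<^sup>2 \<le> (real n)\<^sup>2" and L: "- 1 - 3 * M \<le> L"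
  shows "9 / 2 * M\<^sup>2 - real (n + 1) ^ 4 / 4 \<le> L + 1 / 2 *
      max (2 * C\<^sup>2 * ((9 * M\<^sup>2 - 2 * L) / (real n)\<^sup>2)) (9 * M\<^sup>2 + 2 * L - 1 / 2 * real n ^ 4)"
proof (cases "0 \<le> L")
  case True
  have "real n ^ 4 \<le> real (n + 1) ^ 4" by (intro power_mono) auto
  moreover have "9 / 2 * m - X / 4 \<le> L + 1 / 2 * (9 * m + 2 * L - 1 / 2 * Y)" if "Y \<le> X" for m X Y :: real
    using that True by (simp add: field_simps)
  ultimately have "9 / 2 * M\<^sup>2 - real (n + 1) ^ 4 / 4 \<le> L + 1 / 2 * (9 * M\<^sup>2 + 2 * L - 1 / 2 * real n ^ 4)"
    by blast
  also have "\<dots> \<le> L + 1 / 2 * max (2 * C\<^sup>2 * ((9 * M\<^sup>2 - 2 * L) / (real n)\<^sup>2)) (9 * M\<^sup>2 + 2 * L - 1 / 2 * real n ^ 4)"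
    by (intro add_left_mono mult_left_mono max.cobounded2) simp
  finally show ?thesis .
next
  case False
  have "0 \<le> 9 * M\<^sup>2 - 2 * L" using False zero_le_power2[of M] by linarith
  have "(6 * M)\<^sup>2 \<le> C\<^sup>2" using C(1) M by (intro power_mono) auto
  then have M2: "72 * M\<^sup>2 \<le> (real n)\<^sup>2" using C(2) by (simp add: power_mult_distrib)
  then have "36 * M\<^sup>2 \<le> (real n)\<^sup>2" using zero_le_power2[of M] by linarith
  then have "(6 * M)\<^sup>2 \<le> (real n)\<^sup>2" by (simp add: power_mult_distrib)
  then have M1: "6 * M \<le> real n" by (rule power2_le_imp_le) simp
  have "4 * (real n + 1)\<^sup>2 \<le> (real n + 1)\<^sup>2 * (real n + 1)\<^sup>2"
    using n power_mono[of 2 "real n + 1" 2] by (intro mult_right_mono) auto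
  then have "4 * (real n + 1)\<^sup>2 \<le> real (n + 1) ^ 4" by (simp add: power_numeral_reduce power2_eq_square mult_ac add.commute)
  then have "4 * (real n)\<^sup>2 + 8 * real n + 4 \<le> real (n + 1) ^ 4" by (simp add: power2_sum)
  then have "9 / 2 * M\<^sup>2 - real (n + 1) ^ 4 / 4 \<le> - 1 - 3 * M"
    using M1 M2 zero_le_power2[of "real n"] of_nat_0_le_iff[of n] by linarith
  also have "\<dots> \<le> L" by (rule L)
  also have "\<dots> \<le> L + 1 / 2 * (2 * C\<^sup>2 * ((9 * M\<^sup>2 - 2 * L) / (real n)\<^sup>2))"
    using \<open>0 \<le> 9 * M\<^sup>2 - 2 * L\<close> by simp
  also have "\<dots> \<le> L + 1 / 2 * max (2 * C\<^sup>2 * ((9 * M\<^sup>2 - 2 * L) / (real n)\<^sup>2)) (9 * M\<^sup>2 + 2 * L - 1 / 2 * real n ^ 4)"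
    by (intro add_left_mono mult_left_mono max.cobounded1) simp
  finally show ?thesis .
qed

lemma C_const_bounds: "0 \<le> C_const (trig_sum 0 n a b)" "6 * sup_nrm (trig_sum 2 n a b) \<le> C_const (trig_sum 0 n a b)"
proof -
  have "0 \<le> sup_nrm (trig_sum j n a b)" for j by (intro sup_nrm_nonneg trig_sum_cont_per)
  from this[of 1] this[of 2] this[of 3]
  show "0 \<le> C_const (trig_sum 0 n a b)" "6 * sup_nrm (trig_sum 2 n a b) \<le> C_const (trig_sum 0 n a b)"
    unfolding C_const_def funpow_deriv_trig_sum deriv_trig_sum by (simp_all add: numeral_2_eq_2)
qed

text \<open>The constants in Young's inequality are chosen so that the mixed terms use half of what the
  dissipation \<open>-\<parallel>q\<^sub>x\<^sub>x\<parallel>\<^sup>2/2\<close> offers; the other half gives the tail coefficient through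
  \<open>\<parallel>q\<^sub>x\<^sub>x\<parallel> \<ge> (n + 1)\<^sup>2 \<parallel>q\<parallel>\<close>.\<close>

lemma qform_galerkin_bound:
  fixes n :: nat and a b :: "nat \<Rightarrow> real"
  defines "C \<equiv> C_const (trig_sum 0 n a b)" and "M \<equiv> sup_nrm (trig_sum 2 n a b)" and "L \<equiv> lam_fin n (trig_sum 0 n a b)"
  assumes n: "1 \<le> n" "n \<le> N" and C: "2 * C\<^sup>2 \<le> (real n)\<^sup>2"
  shows "qform n a b N c d \<le> (L + 1 / 2 *
      max (2 * C\<^sup>2 * ((9 * M\<^sup>2 - 2 * L) / (real n)\<^sup>2)) (9 * M\<^sup>2 + 2 * L - 1 / 2 * real n ^ 4))
      * (nrm (trig_sum 0 N c d))\<^sup>2" (is "_ \<le> ?B * _")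
proof -
  define lo where "lo c k = (if k \<le> n then c k else 0)" for c :: "nat \<Rightarrow> real" and k
  define hi where "hi c k = (if k \<le> n then 0 else c k)" for c :: "nat \<Rightarrow> real" and k
  let ?p = "\<lambda>j. trig_sum j N (lo c) (lo d)" and ?q = "\<lambda>j. trig_sum j N (hi c) (hi d)"
  have split: "(\<lambda>k. lo c k + hi c k) = c" "(\<lambda>k. lo d k + hi d k) = d" by (auto simp: lo_def hi_def)
  have orth: "ip (?p j) (?q j) = 0" for j
  proof -
    have "(\<Sum>k=1..N. real k ^ (2*j) * (lo c k * hi c k + lo d k * hi d k)) = 0"
      by (rule sum.neutral) (simp add: lo_def hi_def)
    then show ?thesis unfolding ip_trig_sum_trig_sum by simp
  qed
  have low: "?p j = trig_sum j n c d" for j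
    using trig_sum_truncate[OF n(2), of j c d] by (simp add: lo_def[abs_def])
  define \<alpha> \<beta> P R where "\<alpha> = (nrm (?p 0))\<^sup>2" and "\<beta> = (nrm (?q 0))\<^sup>2" and "P = (nrm (?p 2))\<^sup>2" and "R = (nrm (?q 2))\<^sup>2"
  define Qp Qq where "Qp = qform n a b N (lo c) (lo d)" and "Qq = qform n a b N (hi c) (hi d)"
  have nonneg: "0 \<le> \<alpha>" "0 \<le> \<beta>" by (simp_all add: \<alpha>_def \<beta>_def)
  have C0: "0 \<le> C" and CM: "6 * M \<le> C" unfolding C_def M_def by (rule C_const_bounds)+
  have n0: "real n > 0" using n(1) by simp
  have norm: "(nrm (trig_sum 0 N c d))\<^sup>2 = \<alpha> + \<beta>"
  proof -
    have "trig_sum 0 N c d = (\<lambda>x. ?p 0 x + ?q 0 x)"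
      using trig_sum_add[of 0 N "lo c" "hi c" "lo d" "hi d"] by (simp add: split)
    then show ?thesis
      using orth[of 0] by (simp add: nrm_square \<alpha>_def \<beta>_def ip_add_left ip_add_right trig_sum_L2 L2_add ip_sym[of "?q 0" "?p 0"])
  qed
  have Qp: "Qp \<le> L * \<alpha>"
    using qform_le_lam_fin[of n a b c d] by (simp add: Qp_def L_def \<alpha>_def qform_def low)
  have P: "P \<le> 9 * M\<^sup>2 * \<alpha> - 2 * Qp"
    using qform_upper[of n a b N "lo c" "lo d"] by (simp add: Qp_def P_def M_def \<alpha>_def)
  have Qq: "Qq \<le> - R / 2 + 9 / 2 * M\<^sup>2 * \<beta>"
    using qform_upper[of n a b N "hi c" "hi d"] by (simp add: Qq_def R_def M_def \<beta>_def)
  have hi0: "hi c k = 0 \<and> hi d k = 0" if "k \<le> n" for k using that by (simp add: hi_def)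
  have h: "real (n + 1) * nrm (?q j) \<le> nrm (?q (Suc j))" for j
    using hi0 by (rule nrm_trig_sum_high)
  have h1: "real (n + 1) * nrm (?q 0) \<le> nrm (?q 1)"
    using h[of 0] unfolding One_nat_def .
  have h2: "real (n + 1) * nrm (?q 1) \<le> nrm (?q 2)"
    using h[of 1] unfolding Suc_1 .
  have R: "real (n + 1) ^ 4 * \<beta> \<le> R"
  proof -
    have "real (n + 1) * (real (n + 1) * nrm (?q 0)) \<le> real (n + 1) * nrm (?q 1)"
      using h1 by (rule mult_left_mono) simp
    also have "\<dots> \<le> nrm (?q 2)" by (rule h2)
    finally have "(real (n + 1) * (real (n + 1) * nrm (?q 0)))\<^sup>2 \<le> (nrm (?q 2))\<^sup>2"
      by (intro power_mono mult_nonneg_nonneg nrm_nonneg) auto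
    moreover have "(real (n + 1) * (real (n + 1) * nrm (?q 0)))\<^sup>2 = real (n + 1) ^ 4 * \<beta>"
      by (simp add: \<beta>_def power_mult_distrib power_numeral_reduce power2_eq_square mult_ac)
    ultimately show ?thesis by (simp add: R_def)
  qed
  define \<kappa> where "\<kappa> = C\<^sup>2 / (real n)\<^sup>2"
  have \<kappa>: "0 \<le> \<kappa>" "2 * \<kappa> \<le> 1" using C n0 by (simp_all add: \<kappa>_def field_simps)
  have cross: "C * nrm (?p 2) * nrm (?q 1) \<le> R / 4 + \<kappa> * P"
  proof -
    have "real n * nrm (?q 1) \<le> nrm (?q 2)"
      using h2 nrm_nonneg[of "?q 1"] by (simp add: distrib_right)
    then have "nrm (?q 1) \<le> nrm (?q 2) / real n"
      using n0 by (simp add: field_simps)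
    then have "C * nrm (?p 2) * nrm (?q 1) \<le> C * nrm (?p 2) * (nrm (?q 2) / real n)"
      using C0 nrm_nonneg by (intro mult_left_mono mult_nonneg_nonneg)
    also have "\<dots> = 2 * (C / real n * nrm (?p 2)) * (nrm (?q 2) / 2)" by simp
    also have "\<dots> \<le> (C / real n * nrm (?p 2))\<^sup>2 + (nrm (?q 2) / 2)\<^sup>2"
      by (rule sum_squares_bound)
    also have "\<dots> = R / 4 + \<kappa> * P"
      by (simp add: R_def P_def \<kappa>_def power_mult_distrib power_divide)
    finally show ?thesis .
  qed
  have "qform n a b N c d \<le> Qp + Qq + C * nrm (?p 2) * nrm (?q 1)"
    using qform_cross[OF orth[of 2], of n a b] by (simp add: split Qp_def Qq_def C_def)
  also have "\<dots> \<le> Qp + \<kappa> * P + (9 / 2 * M\<^sup>2 * \<beta> - R / 4)"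
    using Qq cross by simp
  also have "\<dots> \<le> Qp + \<kappa> * (9 * M\<^sup>2 * \<alpha> - 2 * Qp) + (9 / 2 * M\<^sup>2 * \<beta> - R / 4)"
    using mult_left_mono[OF P \<kappa>(1)] by simp
  also have "\<dots> \<le> Qp + \<kappa> * (9 * M\<^sup>2 * \<alpha> - 2 * Qp) + (9 / 2 * M\<^sup>2 - real (n + 1) ^ 4 / 4) * \<beta>"
    using R by (simp add: left_diff_distrib)
  also have "\<dots> = (1 - 2 * \<kappa>) * Qp + \<kappa> * (9 * M\<^sup>2 * \<alpha>) + (9 / 2 * M\<^sup>2 - real (n + 1) ^ 4 / 4) * \<beta>"
    by (simp add: algebra_simps)
  also have "\<dots> \<le> (1 - 2 * \<kappa>) * (L * \<alpha>) + \<kappa> * (9 * M\<^sup>2 * \<alpha>) + (9 / 2 * M\<^sup>2 - real (n + 1) ^ 4 / 4) * \<beta>"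
    using mult_left_mono[OF Qp, of "1 - 2 * \<kappa>"] \<kappa>(2) by simp
  also have "\<dots> = (L + \<kappa> * (9 * M\<^sup>2 - 2 * L)) * \<alpha> + (9 / 2 * M\<^sup>2 - real (n + 1) ^ 4 / 4) * \<beta>"
    by (simp add: algebra_simps)
  also have "\<dots> \<le> ?B * \<alpha> + ?B * \<beta>"
  proof (rule add_mono[OF mult_right_mono mult_right_mono])
    have "\<kappa> * (9 * M\<^sup>2 - 2 * L) = 1 / 2 * (2 * C\<^sup>2 * ((9 * M\<^sup>2 - 2 * L) / (real n)\<^sup>2))"
      by (simp add: \<kappa>_def)
    then show "L + \<kappa> * (9 * M\<^sup>2 - 2 * L) \<le> ?B"
      by (simp only:) (intro add_left_mono mult_left_mono max.cobounded1, simp)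
    have "0 \<le> M" unfolding M_def by (intro sup_nrm_nonneg trig_sum_cont_per)
    moreover have "- 1 - 3 * M \<le> L" unfolding M_def L_def using n(1) by (rule lam_fin_lower)
    ultimately show "9 / 2 * M\<^sup>2 - real (n + 1) ^ 4 / 4 \<le> ?B"
      using n(1) CM C by (intro tail_coefficient_bound)
  qed (rule nonneg)+
  also have "\<dots> = ?B * (nrm (trig_sum 0 N c d))\<^sup>2" by (simp add: norm distrib_left)
  finally show ?thesis .
qed

theorem theorem2:
  fixes T t :: real and n :: nat and u \<phi> :: "real \<Rightarrow> real \<Rightarrow> real"
  assumes "smooth_local_solution T u"
    and "n \<ge> 1"
    and "\<And>s. s \<in> {0..<T} \<Longrightarrow> \<phi> s \<in> H_fin n"
    and "t \<in> {0..<T}"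
    and "real n \<ge> sqrt 2 * C_const (\<phi> t)"
  shows "lam_fin n (\<phi> t) \<le> lam (\<phi> t) \<and>
    lam (\<phi> t) \<le> lam_fin n (\<phi> t) + 1 / 2 *
      max (2 * (C_const (\<phi> t))\<^sup>2 *
             ((9 * (sup_nrm ((deriv ^^ 2) (\<phi> t)))\<^sup>2 - 2 * lam_fin n (\<phi> t)) / (real n)\<^sup>2))
          (9 * (sup_nrm ((deriv ^^ 2) (\<phi> t)))\<^sup>2 + 2 * lam_fin n (\<phi> t) - 1 / 2 * (real n) ^ 4)"
proof -
  obtain a b where phi: "\<phi> t = trig_sum 0 n a b"
    using assms(3)[OF assms(4)] by (auto simp: H_fin_iff)
  have d2: "(deriv ^^ 2) (trig_sum 0 n a b) = trig_sum 2 n a b" by (simp only: funpow_deriv_trig_sum add_0_right)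
  let ?S = "{ip (A_op (\<phi> t) u) u | u. u \<in> H_sob 4 \<and> nrm u = 1}"
  let ?S' = "{ip (A_op (\<phi> t) u) u | u. u \<in> H_fin n \<and> nrm u = 1}"
  define B where "B = lam_fin n (\<phi> t) + 1 / 2 *
      max (2 * (C_const (\<phi> t))\<^sup>2 *
             ((9 * (sup_nrm ((deriv ^^ 2) (\<phi> t)))\<^sup>2 - 2 * lam_fin n (\<phi> t)) / (real n)\<^sup>2))
          (9 * (sup_nrm ((deriv ^^ 2) (\<phi> t)))\<^sup>2 + 2 * lam_fin n (\<phi> t) - 1 / 2 * (real n) ^ 4)"
  have C: "2 * (C_const (trig_sum 0 n a b))\<^sup>2 \<le> (real n)\<^sup>2"
  proof -
    have "(sqrt 2 * C_const (\<phi> t))\<^sup>2 \<le> (real n)\<^sup>2"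
      using assms(5) C_const_bounds(1)[of n a b] by (intro power_mono) (simp_all add: phi)
    then show ?thesis by (simp add: power_mult_distrib phi)
  qed
  have bound: "ip (A_op (\<phi> t) v) v \<le> B" if v: "v \<in> H_sob 4" "nrm v = 1" for v
  proof (rule LIMSEQ_le)
    let ?v = "\<lambda>N. trig_sum 0 N (fourier_cos v) (fourier_sin v)"
    show "(\<lambda>N. qform n a b N (fourier_cos v) (fourier_sin v)) \<longlonglongrightarrow> ip (A_op (\<phi> t) v) v"
      unfolding phi by (rule qform_limit(1)[OF v(1)])
    have "(\<lambda>N. B * (nrm (?v N))\<^sup>2) \<longlonglongrightarrow> B * (nrm v)\<^sup>2"
      by (intro tendsto_intros qform_limit(2)[OF v(1)])
    then show "(\<lambda>N. B * (nrm (?v N))\<^sup>2) \<longlonglongrightarrow> B" by (simp add: v(2))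
    show "\<exists>N0. \<forall>N\<ge>N0. qform n a b N (fourier_cos v) (fourier_sin v) \<le> B * (nrm (?v N))\<^sup>2"
      using qform_galerkin_bound[OF assms(2) _ C] unfolding B_def phi d2 by blast
  qed
  have sub: "?S' \<subseteq> ?S" using trig_sum_H_sob by (auto simp: H_fin_iff)
  have ne: "?S' \<noteq> {}"
    using nrm_unit_cos[OF assms(2), of 0] by (auto simp: H_fin_iff)
  have "lam_fin n (\<phi> t) \<le> lam (\<phi> t)"
    unfolding lam_def lam_fin_def using ne sub bound
    by (intro cSup_subset_mono bdd_aboveI[of _ B]) auto
  moreover have "lam (\<phi> t) \<le> B"
    unfolding lam_def using ne sub bound by (intro cSup_least) auto
  ultimately show ?thesis by (simp add: B_def)
qed

end
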